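(* Let $\alpha,\beta>0$, let $L$, $(\mu_n)$, $A$, $\mathcal{H}_i$ ($i=1,2,3,4$), $m_1,m_2$ and $\langle\cdot,\cdot\rangle_{G_i}$ be as in the context. (1) If $\mu_n\neq m_1$ and $\mu_n\ne m_2$ for all eigenvalues $\mu_n$ of $L$, then for each $i\in\{1,2,3,4\}$ the explicit formula for $\langle\cdot,\cdot\rangle_{G_i}$ defines a scalar product on $\mathcal{H}_i$ whose norm is equivalent to the natural norm of $\mathcal{H}_i$, and with respect to $\langle\cdot,\cdot\rangle_{G_i}$ the operator $A$ on $\mathcal{H}_i$ is a normal operator. Moreover, there exists a set $\{\Psi^{n,i}_j : j=1,2,3,\ n=1,2,\ldots\}$ of eigenfunctions of $A$ which is orthonormal with respect to $\langle\cdot,\cdot\rangle_{G_i}$ and complete in $\mathcal{H}_i$. (2) Conversely, if one of the eigenvalues $\mu_n$ of $L$ coincides with one of the two numbers $m_1$ or $m_2$ (including the case $m_1=m_2$), then the operator $A$ on $\mathcal{H}_i$ is not normal with respect to any scalar product.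
   Context: $H$ is an (infinite-dimensional, complex) Hilbert space and $L$ is a self-adjoint, strictly positive operator in $H$ with compact resolvent. Its eigenvalues, repeated according to multiplicity, are $0<\mu_1\le\mu_2\le\dots\to\infty$, with an orthonormal basis of eigenfunctions $\phi_n$, $L\phi_n=\mu_n\phi_n$. The equation $(u+\alpha u_t)_{tt}+L(u+\beta u_t)=0$ is written, with $U=(u,v,w)^T=(u,u_t,u_{tt})^T$, as $\frac{dU}{dt}=AU$, where $$A(u,v,w)^T=\Big(v,\; w,\; -\tfrac1\alpha L(u+\beta v)-\tfrac1\alpha w\Big)^T .$$ The operator $A$ is considered in each of the Hilbert spaces $$\mathcal{H}_1=D(L^{1/2})\times D(L^{1/2})\times H,\quad \mathcal{H}_2=D(L)\times D(L)\times D(L^{1/2}),$$ $$\mathcal{H}_3=D(L)\times D(L^{1/2})\times H,\quad \mathcal{H}_4=D(L^{3/2})\times D(L)\times D(L^{1/2}),$$ where $D(L^s)$ carries the norm $\|L^s\cdot\|_H$. The domain is $D(A)=\{U\in\mathcal{H}_i: AU\in\mathcal{H}_i\}$ (with $L(u+\beta v)$ understood through the expansion in $\phi_n$); e.g. for $\mathcal{H}_1$, $D(A)=\{(u,v,w)\in \mathcal{H}_1: w\in D(L^{1/2}),\ u+\beta v\in D(L)\}$. The numbers $m_1,m_2$ (possibly nonreal) are $$m_1=\alpha\frac{-C_1-\sqrt{C_2}}{8\beta^3},\quad m_2=\alpha\frac{-C_1+\sqrt{C_2}}{8\beta^3},$$ $$C_1=27-18\frac{\beta}{\alpha}-\Big(\frac{\beta}{\alpha}\Big)^2,\quad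 C_2=C_1^2-64\Big(\frac{\beta}{\alpha}\Big)^3 .$$ Definition of $\langle\cdot,\cdot\rangle_{G_i}$. Let $E_n$ be the three-dimensional space spanned by $(\phi_n,0,0),(0,\phi_n,0),(0,0,\phi_n)$, so that $\mathcal{H}_i=\bigoplus_{n\ge1}E_n$ (orthogonal sum for the natural scalar product). In this basis the natural scalar product of $\mathcal{H}_i$ restricted to $E_n$ has matrix $O_{n,i}$ with $O_{n,1}=\mathrm{diag}(\mu_n,\mu_n,1)$, $O_{n,3}=\mathrm{diag}(\mu_n^2,\mu_n,1)$, $O_{n,2}=\mu_nO_{n,1}$, $O_{n,4}=\mu_nO_{n,3}$. Let $\lambda_1^n,\lambda_2^n,\lambda_3^n$ be the three roots of $\alpha\lambda^3+\lambda^2+\beta\mu_n\lambda+\mu_n=0$; put $\Psi^{n,i}_j=(1,\lambda^n_j,(\lambda^n_j)^2)^T/c^{n,i}_j$ (coordinates in the basis $(\phi_n,0,0),(0,\phi_n,0),(0,0,\phi_n)$ of $E_n$), where $c_j^{n,i}>0$ normalizes $\Psi^{n,i}_j$ to norm one in the norm given by $O_{n,i}$. When the three roots are distinct, let $C_{n,i}$ be the matrix with columns $\Psi^{n,i}_1,\Psi^{n,i}_2,\Psi^{n,i}_3$ and $G_{n,i}=(\overline{C_{n,i}^{-1}})^T C_{n,i}^{-1}$. The scalar product $\langle\cdot,\cdot\rangle_{G_i}$ is the one for which the spaces $E_n$ are mutually orthogonal and whose restriction to $E_n$ has matrix $G_{n,i}$, i.e. $\|(x,y,z)\|^2_{G_{n,i}}=(\bar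 x,\bar y,\bar z)\,G_{n,i}\,(x,y,z)^T$. *)

theory Defs
  imports "HOL-Analysis.Analysis" "HOL-Computational_Algebra.Polynomial"
begin

section \<open>Complex vector spaces and complex Hilbert spaces\<close>

class complex_vector = real_vector +
  fixes scaleC :: "complex \<Rightarrow> 'a \<Rightarrow> 'a" (infixr "*\<^sub>C" 75)
  assumes scaleC_add_right: "a *\<^sub>C (x + y) = a *\<^sub>C x + a *\<^sub>C y"
    and scaleC_add_left: "(a + b) *\<^sub>C x = a *\<^sub>C x + b *\<^sub>C x"
    and scaleC_scaleC: "a *\<^sub>C b *\<^sub>C x = (a * b) *\<^sub>C x"
    and scaleC_one: "1 *\<^sub>C x = x"
    and scaleR_scaleC: "r *\<^sub>R x = complex_of_real r *\<^sub>C x"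

instantiation prod :: (complex_vector, complex_vector) complex_vector
begin

definition scaleC_prod :: "complex \<Rightarrow> 'a \<times> 'b \<Rightarrow> 'a \<times> 'b" where
  "scaleC_prod c p = (c *\<^sub>C fst p, c *\<^sub>C snd p)"

instance
  by standard
    (simp_all add: scaleC_prod_def scaleC_add_right scaleC_add_left scaleC_scaleC
      scaleC_one scaleR_prod_def scaleR_scaleC)

end

abbreviation csubspace :: "'a::complex_vector set \<Rightarrow> bool" where
  "csubspace \<equiv> module.subspace scaleC"

abbreviation cspan :: "'a::complex_vector set \<Rightarrow> 'a set" where
  "cspan \<equiv> module.span scaleC"

text \<open>All scalar products are conjugate-linear in the first argument.\<close>

class complex_hilbert = complex_vector + banach +
  fixes cinner :: "'a \<Rightarrow> 'a \<Rightarrow> complex"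
  assumes cinner_commute: "cinner x y = cnj (cinner y x)"
    and cinner_add_right: "cinner x (y + z) = cinner x y + cinner x z"
    and cinner_scaleC_right: "cinner x (c *\<^sub>C y) = c * cinner x y"
    and cinner_self: "cinner x x = complex_of_real ((norm x)\<^sup>2)"

section \<open>Scalar products on a subspace, and unbounded operators\<close>

text \<open>The same vector space is considered with several scalar products, so a space is given by
  a carrier \<open>V\<close> and a scalar product \<open>ip\<close>; a partially defined operator
  is given by a domain \<open>D\<close> and a total function \<open>T\<close> whose values outside
  \<open>D\<close> are irrelevant.\<close>

definition is_scalar_product :: "'v::complex_vector set \<Rightarrow> ('v \<Rightarrow> 'v \<Rightarrow> complex) \<Rightarrow> bool" where
  "is_scalar_product V ip \<longleftrightarrow>
     csubspace V \<and>
     (\<forall>x\<in>V. \<forall>y\<in>V. \<forall>z\<in>V. ip x (y + z) = ip x y + ip x z) \<and>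
     (\<forall>x\<in>V. \<forall>y\<in>V. \<forall>c. ip x (c *\<^sub>C y) = c * ip x y) \<and>
     (\<forall>x\<in>V. \<forall>y\<in>V. ip x y = cnj (ip y x)) \<and>
     (\<forall>x\<in>V. x \<noteq> 0 \<longrightarrow> Re (ip x x) > 0)"

definition ip_norm :: "('v \<Rightarrow> 'v \<Rightarrow> complex) \<Rightarrow> 'v \<Rightarrow> real" where
  "ip_norm ip x = sqrt (Re (ip x x))"

definition equivalent_norms ::
  "'v set \<Rightarrow> ('v \<Rightarrow> 'v \<Rightarrow> complex) \<Rightarrow> ('v \<Rightarrow> 'v \<Rightarrow> complex) \<Rightarrow> bool" where
  "equivalent_norms V ip ip' \<longleftrightarrow>
     (\<exists>c>0. \<exists>C>0. \<forall>x\<in>V. c * ip_norm ip' x \<le> ip_norm ip x \<and> ip_norm ip x \<le> C * ip_norm ip' x)"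

definition dense_in ::
  "'v::complex_vector set \<Rightarrow> ('v \<Rightarrow> 'v \<Rightarrow> complex) \<Rightarrow> 'v set \<Rightarrow> bool" where
  "dense_in V ip D \<longleftrightarrow> D \<subseteq> V \<and> (\<forall>x\<in>V. \<forall>e>0. \<exists>d\<in>D. ip_norm ip (x - d) < e)"

definition orthonormal :: "('v \<Rightarrow> 'v \<Rightarrow> complex) \<Rightarrow> ('k \<Rightarrow> 'v) \<Rightarrow> bool" where
  "orthonormal ip e \<longleftrightarrow> (\<forall>k l. ip (e k) (e l) = (if k = l then 1 else 0))"

definition complete_in ::
  "'v::complex_vector set \<Rightarrow> ('v \<Rightarrow> 'v \<Rightarrow> complex) \<Rightarrow> ('k \<Rightarrow> 'v) \<Rightarrow> bool" where
  "complete_in V ip e \<longleftrightarrow> dense_in V ip (cspan (range e))"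

definition densely_defined_operator ::
  "'v::complex_vector set \<Rightarrow> ('v \<Rightarrow> 'v \<Rightarrow> complex) \<Rightarrow> 'v set \<Rightarrow> ('v \<Rightarrow> 'v) \<Rightarrow> bool" where
  "densely_defined_operator V ip D T \<longleftrightarrow>
     csubspace D \<and> dense_in V ip D \<and> T ` D \<subseteq> V \<and>
     (\<forall>x\<in>D. \<forall>y\<in>D. T (x + y) = T x + T y) \<and>
     (\<forall>c. \<forall>x\<in>D. T (c *\<^sub>C x) = c *\<^sub>C T x)"

definition adj_dom ::
  "'v set \<Rightarrow> ('v \<Rightarrow> 'v \<Rightarrow> complex) \<Rightarrow> 'v set \<Rightarrow> ('v \<Rightarrow> 'v) \<Rightarrow> 'v set" where
  "adj_dom V ip D T = {y \<in> V. \<exists>z\<in>V. \<forall>x\<in>D. ip (T x) y = ip x z}"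

definition adj ::
  "'v set \<Rightarrow> ('v \<Rightarrow> 'v \<Rightarrow> complex) \<Rightarrow> 'v set \<Rightarrow> ('v \<Rightarrow> 'v) \<Rightarrow> 'v \<Rightarrow> 'v" where
  "adj V ip D T y = (THE z. z \<in> V \<and> (\<forall>x\<in>D. ip (T x) y = ip x z))"

definition self_adjoint ::
  "'v::complex_vector set \<Rightarrow> ('v \<Rightarrow> 'v \<Rightarrow> complex) \<Rightarrow> 'v set \<Rightarrow> ('v \<Rightarrow> 'v) \<Rightarrow> bool" where
  "self_adjoint V ip D T \<longleftrightarrow>
     densely_defined_operator V ip D T \<and>
     adj_dom V ip D T = D \<and> (\<forall>x\<in>D. adj V ip D T x = T x)"

text \<open>Normality of an unbounded operator in the sense of Weidmann and Schmuedgen: \<open>T\<close> is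
  densely defined, \<open>D(T) = D(T*)\<close> and \<open>\<parallel>T x\<parallel> = \<parallel>T* x\<parallel>\<close> on it.  In a Hilbert space this
  is the same as: \<open>T\<close> is closed, densely defined and \<open>T T* = T* T\<close>.  The definition
  also makes sense when \<open>ip\<close> is not complete on \<open>V\<close>.\<close>

definition normal_operator ::
  "'v::complex_vector set \<Rightarrow> ('v \<Rightarrow> 'v \<Rightarrow> complex) \<Rightarrow> 'v set \<Rightarrow> ('v \<Rightarrow> 'v) \<Rightarrow> bool" where
  "normal_operator V ip D T \<longleftrightarrow>
     densely_defined_operator V ip D T \<and>
     adj_dom V ip D T = D \<and>
     (\<forall>x\<in>D. ip_norm ip (T x) = ip_norm ip (adj V ip D T x))"

definition eigenvector_of :: "'v::complex_vector set \<Rightarrow> ('v \<Rightarrow> 'v) \<Rightarrow> 'v \<Rightarrow> bool" where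
  "eigenvector_of D T x \<longleftrightarrow> x \<in> D \<and> x \<noteq> 0 \<and> (\<exists>z. T x = z *\<^sub>C x)"

definition strictly_positive :: "'a::complex_hilbert set \<Rightarrow> ('a \<Rightarrow> 'a) \<Rightarrow> bool" where
  "strictly_positive D T \<longleftrightarrow> (\<forall>x\<in>D. x \<noteq> 0 \<longrightarrow> Re (cinner x (T x)) > 0)"

definition compact_resolvent :: "'a::complex_hilbert set \<Rightarrow> ('a \<Rightarrow> 'a) \<Rightarrow> bool" where
  "compact_resolvent D T \<longleftrightarrow>
     (\<exists>z. bij_betw (\<lambda>x. T x - z *\<^sub>C x) D UNIV \<and>
          compact (closure (the_inv_into D (\<lambda>x. T x - z *\<^sub>C x) ` cball 0 1)))"

text \<open>The sequences are indexed from \<open>0\<close>.  Since \<open>\<phi>\<close> is orthonormal, complete and indexed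
  by the natural numbers, the space is automatically infinite-dimensional, and every eigenvalue
  occurs in \<open>\<mu>\<close> as often as its multiplicity says.\<close>

definition spectral_data ::
  "'a::complex_hilbert set \<Rightarrow> ('a \<Rightarrow> 'a) \<Rightarrow> (nat \<Rightarrow> real) \<Rightarrow> (nat \<Rightarrow> 'a) \<Rightarrow> bool" where
  "spectral_data D T \<mu> \<phi> \<longleftrightarrow>
     orthonormal cinner \<phi> \<and> complete_in UNIV cinner \<phi> \<and>
     (\<forall>n. \<phi> n \<in> D \<and> T (\<phi> n) = \<mu> n *\<^sub>R \<phi> n) \<and>
     (\<forall>n. 0 < \<mu> n) \<and> mono \<mu> \<and> filterlim \<mu> at_top sequentially"

section \<open>Fractional powers and the phase spaces\<close>

definition pow_dom :: "(nat \<Rightarrow> real) \<Rightarrow> (nat \<Rightarrow> 'a::complex_hilbert) \<Rightarrow> real \<Rightarrow> 'a set" where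
  "pow_dom \<mu> \<phi> s = {x. summable (\<lambda>n. (\<mu> n powr s * cmod (cinner (\<phi> n) x))\<^sup>2)}"

definition pow_op ::
  "(nat \<Rightarrow> real) \<Rightarrow> (nat \<Rightarrow> 'a::complex_hilbert) \<Rightarrow> real \<Rightarrow> 'a \<Rightarrow> 'a" where
  "pow_op \<mu> \<phi> s x = (\<Sum>n. (complex_of_real (\<mu> n powr s) * cinner (\<phi> n) x) *\<^sub>C \<phi> n)"

datatype space_index = I1 | I2 | I3 | I4

fun phase_space ::
  "'a::complex_hilbert set \<Rightarrow> (nat \<Rightarrow> real) \<Rightarrow> (nat \<Rightarrow> 'a) \<Rightarrow> space_index \<Rightarrow> ('a \<times> 'a \<times> 'a) set" where
  "phase_space D \<mu> \<phi> I1 = pow_dom \<mu> \<phi> (1/2) \<times> pow_dom \<mu> \<phi> (1/2) \<times> UNIV"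
| "phase_space D \<mu> \<phi> I2 = D \<times> D \<times> pow_dom \<mu> \<phi> (1/2)"
| "phase_space D \<mu> \<phi> I3 = D \<times> pow_dom \<mu> \<phi> (1/2) \<times> UNIV"
| "phase_space D \<mu> \<phi> I4 = pow_dom \<mu> \<phi> (3/2) \<times> D \<times> pow_dom \<mu> \<phi> (1/2)"

definition ip_via :: "('a \<Rightarrow> 'a::complex_hilbert) \<Rightarrow> 'a \<Rightarrow> 'a \<Rightarrow> complex" where
  "ip_via S x y = cinner (S x) (S y)"

fun natural_ip ::
  "('a::complex_hilbert \<Rightarrow> 'a) \<Rightarrow> (nat \<Rightarrow> real) \<Rightarrow> (nat \<Rightarrow> 'a) \<Rightarrow> space_index \<Rightarrow>
     'a \<times> 'a \<times> 'a \<Rightarrow> 'a \<times> 'a \<times> 'a \<Rightarrow> complex" where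
  "natural_ip T \<mu> \<phi> I1 (u, v, w) (u', v', w') =
     ip_via (pow_op \<mu> \<phi> (1/2)) u u' + ip_via (pow_op \<mu> \<phi> (1/2)) v v' + cinner w w'"
| "natural_ip T \<mu> \<phi> I2 (u, v, w) (u', v', w') =
     ip_via T u u' + ip_via T v v' + ip_via (pow_op \<mu> \<phi> (1/2)) w w'"
| "natural_ip T \<mu> \<phi> I3 (u, v, w) (u', v', w') =
     ip_via T u u' + ip_via (pow_op \<mu> \<phi> (1/2)) v v' + cinner w w'"
| "natural_ip T \<mu> \<phi> I4 (u, v, w) (u', v', w') =
     ip_via (pow_op \<mu> \<phi> (3/2)) u u' + ip_via T v v' + ip_via (pow_op \<mu> \<phi> (1/2)) w w'"

section \<open>The operator of the equation\<close>

definition mgt_op ::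
  "real \<Rightarrow> real \<Rightarrow> ('a::complex_hilbert \<Rightarrow> 'a) \<Rightarrow> 'a \<times> 'a \<times> 'a \<Rightarrow> 'a \<times> 'a \<times> 'a" where
  "mgt_op \<alpha> \<beta> T = (\<lambda>(u, v, w). (v, w, - ((1/\<alpha>) *\<^sub>R T (u + \<beta> *\<^sub>R v)) - (1/\<alpha>) *\<^sub>R w))"

text \<open>The third component of every phase space is contained in \<open>H\<close>, so the expansion of
  \<open>L (u + \<beta> v)\<close> can only give an element of it if \<open>u + \<beta> v\<close> lies in the domain of \<open>L\<close>.\<close>

definition mgt_dom ::
  "real \<Rightarrow> real \<Rightarrow> 'a::complex_hilbert set \<Rightarrow> ('a \<Rightarrow> 'a) \<Rightarrow> (nat \<Rightarrow> real) \<Rightarrow> (nat \<Rightarrow> 'a) \<Rightarrow>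
     space_index \<Rightarrow> ('a \<times> 'a \<times> 'a) set" where
  "mgt_dom \<alpha> \<beta> D T \<mu> \<phi> i =
     {(u, v, w). (u, v, w) \<in> phase_space D \<mu> \<phi> i \<and> u + \<beta> *\<^sub>R v \<in> D \<and>
        mgt_op \<alpha> \<beta> T (u, v, w) \<in> phase_space D \<mu> \<phi> i}"

definition C1 :: "real \<Rightarrow> real \<Rightarrow> real" where
  "C1 \<alpha> \<beta> = 27 - 18 * (\<beta> / \<alpha>) - (\<beta> / \<alpha>)\<^sup>2"

definition C2 :: "real \<Rightarrow> real \<Rightarrow> real" where
  "C2 \<alpha> \<beta> = (C1 \<alpha> \<beta>)\<^sup>2 - 64 * (\<beta> / \<alpha>) ^ 3"

definition m1 :: "real \<Rightarrow> real \<Rightarrow> complex" where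
  "m1 \<alpha> \<beta> = of_real \<alpha> * ((- of_real (C1 \<alpha> \<beta>) - csqrt (of_real (C2 \<alpha> \<beta>))) / of_real (8 * \<beta> ^ 3))"

definition m2 :: "real \<Rightarrow> real \<Rightarrow> complex" where
  "m2 \<alpha> \<beta> = of_real \<alpha> * ((- of_real (C1 \<alpha> \<beta>) + csqrt (of_real (C2 \<alpha> \<beta>))) / of_real (8 * \<beta> ^ 3))"

section \<open>The scalar products built from the eigenvectors\<close>

definition characteristic_roots ::
  "real \<Rightarrow> real \<Rightarrow> (nat \<Rightarrow> real) \<Rightarrow> (nat \<Rightarrow> 3 \<Rightarrow> complex) \<Rightarrow> bool" where
  "characteristic_roots \<alpha> \<beta> \<mu> \<rho> \<longleftrightarrow>
     (\<forall>n. [:of_real (\<mu> n), of_real (\<beta> * \<mu> n), 1, of_real \<alpha>:] =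
            smult (of_real \<alpha>) (\<Prod>j\<in>UNIV. [:- \<rho> n j, 1:]))"

definition herm_form :: "complex^3^3 \<Rightarrow> complex^3 \<Rightarrow> complex^3 \<Rightarrow> complex" where
  "herm_form M x y = (\<Sum>k\<in>UNIV. cnj (x $ k) * (M *v y) $ k)"

definition diag3 :: "real \<Rightarrow> real \<Rightarrow> real \<Rightarrow> complex^3^3" where
  "diag3 a b c = (\<chi> k l. if k = l then of_real ((vector [a, b, c] :: real^3) $ k) else 0)"

fun O_mat :: "(nat \<Rightarrow> real) \<Rightarrow> space_index \<Rightarrow> nat \<Rightarrow> complex^3^3" where
  "O_mat \<mu> I1 n = diag3 (\<mu> n) (\<mu> n) 1"
| "O_mat \<mu> I2 n = \<mu> n *\<^sub>R diag3 (\<mu> n) (\<mu> n) 1"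
| "O_mat \<mu> I3 n = diag3 ((\<mu> n)\<^sup>2) (\<mu> n) 1"
| "O_mat \<mu> I4 n = \<mu> n *\<^sub>R diag3 ((\<mu> n)\<^sup>2) (\<mu> n) 1"

definition root_vec :: "complex \<Rightarrow> complex^3" where
  "root_vec l = vector [1, l, l\<^sup>2]"

definition psi_norm ::
  "(nat \<Rightarrow> real) \<Rightarrow> (nat \<Rightarrow> 3 \<Rightarrow> complex) \<Rightarrow> space_index \<Rightarrow> nat \<Rightarrow> 3 \<Rightarrow> real" where
  "psi_norm \<mu> \<rho> i n j = ip_norm (herm_form (O_mat \<mu> i n)) (root_vec (\<rho> n j))"

definition psi_vec ::
  "(nat \<Rightarrow> real) \<Rightarrow> (nat \<Rightarrow> 3 \<Rightarrow> complex) \<Rightarrow> space_index \<Rightarrow> nat \<Rightarrow> 3 \<Rightarrow> complex^3" where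
  "psi_vec \<mu> \<rho> i n j = (1 / psi_norm \<mu> \<rho> i n j) *\<^sub>R root_vec (\<rho> n j)"

definition C_mat ::
  "(nat \<Rightarrow> real) \<Rightarrow> (nat \<Rightarrow> 3 \<Rightarrow> complex) \<Rightarrow> space_index \<Rightarrow> nat \<Rightarrow> complex^3^3" where
  "C_mat \<mu> \<rho> i n = (\<chi> k j. psi_vec \<mu> \<rho> i n j $ k)"

definition G_mat ::
  "(nat \<Rightarrow> real) \<Rightarrow> (nat \<Rightarrow> 3 \<Rightarrow> complex) \<Rightarrow> space_index \<Rightarrow> nat \<Rightarrow> complex^3^3" where
  "G_mat \<mu> \<rho> i n =
     transpose (map_matrix cnj (matrix_inv (C_mat \<mu> \<rho> i n))) ** matrix_inv (C_mat \<mu> \<rho> i n)"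

text \<open>The coordinates of the projection to \<open>E\<^sub>n\<close>, and the vector of \<open>E\<^sub>n\<close> with given coordinates.\<close>

definition coords :: "(nat \<Rightarrow> 'a::complex_hilbert) \<Rightarrow> nat \<Rightarrow> 'a \<times> 'a \<times> 'a \<Rightarrow> complex^3" where
  "coords \<phi> n = (\<lambda>(u, v, w). vector [cinner (\<phi> n) u, cinner (\<phi> n) v, cinner (\<phi> n) w])"

definition embed :: "(nat \<Rightarrow> 'a::complex_hilbert) \<Rightarrow> nat \<Rightarrow> complex^3 \<Rightarrow> 'a \<times> 'a \<times> 'a" where
  "embed \<phi> n x = (x $ 1 *\<^sub>C \<phi> n, x $ 2 *\<^sub>C \<phi> n, x $ 3 *\<^sub>C \<phi> n)"

definition G_term ::
  "(nat \<Rightarrow> real) \<Rightarrow> (nat \<Rightarrow> 'a::complex_hilbert) \<Rightarrow> (nat \<Rightarrow> 3 \<Rightarrow> complex) \<Rightarrow> space_index \<Rightarrow>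
     'a \<times> 'a \<times> 'a \<Rightarrow> 'a \<times> 'a \<times> 'a \<Rightarrow> nat \<Rightarrow> complex" where
  "G_term \<mu> \<phi> \<rho> i U V n = herm_form (G_mat \<mu> \<rho> i n) (coords \<phi> n U) (coords \<phi> n V)"

definition G_ip ::
  "(nat \<Rightarrow> real) \<Rightarrow> (nat \<Rightarrow> 'a::complex_hilbert) \<Rightarrow> (nat \<Rightarrow> 3 \<Rightarrow> complex) \<Rightarrow> space_index \<Rightarrow>
     'a \<times> 'a \<times> 'a \<Rightarrow> 'a \<times> 'a \<times> 'a \<Rightarrow> complex" where
  "G_ip \<mu> \<phi> \<rho> i U V = (\<Sum>n. G_term \<mu> \<phi> \<rho> i U V n)"

definition Psi ::
  "(nat \<Rightarrow> real) \<Rightarrow> (nat \<Rightarrow> 'a::complex_hilbert) \<Rightarrow> (nat \<Rightarrow> 3 \<Rightarrow> complex) \<Rightarrow> space_index \<Rightarrow>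
     nat \<times> 3 \<Rightarrow> 'a \<times> 'a \<times> 'a" where
  "Psi \<mu> \<phi> \<rho> i = (\<lambda>(n, j). embed \<phi> n (psi_vec \<mu> \<rho> i n j))"

end

theory Submission
  imports Defs
begin

text \<open>The spaces \<open>E\<^sub>n\<close> are invariant, and on \<open>E\<^sub>n\<close> the operator is the companion matrix of the cubic
\<open>\<alpha> l\<^sup>3 + l\<^sup>2 + \<beta> \<mu>\<^sub>n l + \<mu>\<^sub>n\<close>, with eigenvector \<open>(1, l, l\<^sup>2)\<close> for a root \<open>l\<close>. The numbers \<open>m1\<close> and \<open>m2\<close>
are the zeros of the quadratic factor of the discriminant of this cubic in \<open>\<mu>\<^sub>n\<close>, so the two parts
of the theorem are the cases of three distinct roots for every \<open>n\<close> and of a multiple root for some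
\<open>n\<close> (\<open>multiple_root_iff\<close>).

If all roots are distinct, the normalized eigenvectors of \<open>E\<^sub>n\<close> are a basis which the scalar product
\<open>G_ip\<close> declares to be orthonormal. In the coordinates with respect to these bases the phase space
becomes a space of square-summable sequences and the operator becomes multiplication by the roots on
its maximal domain; such an operator is normal (\<open>diagonal_operator\<close>), whatever the location of the
roots.

What has to be proved is that the coordinates are square summable exactly for the vectors of
the phase space, with equivalent norms: the bases must be well conditioned uniformly in \<open>n\<close>. Rescale
the coordinates so that the natural scalar product becomes the standard one. The eigenvectors are
then the columns of a \<open>3 \<times> 3\<close> matrix with entries of modulus at most \<open>1\<close>, and by Cramer's rule its
inverse is bounded as soon as its determinant, a Vandermonde determinant divided by the norms of
the columns, is bounded away from zero. For each single \<open>n\<close> the determinant is nonzero. As \<open>\<mu>\<^sub>n\<close> grows,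
one root stays real and bounded, and the other two become a complex conjugate pair of modulus
about \<open>sqrt (\<beta> \<mu>\<^sub>n / \<alpha>)\<close>; in each of the four phase spaces the powers of \<open>\<mu>\<^sub>n\<close> in the determinant
cancel and a positive lower bound remains (\<open>Gram_lower_bound\<close>, \<open>Riesz_bound\<close>).

If the cubic has a multiple root for some \<open>n\<close>, the companion matrix, being nonderogatory, has a
nontrivial Jordan chain in \<open>E\<^sub>n\<close>. A normal operator has none, for any scalar product: an
eigenvector of it is also an eigenvector of its adjoint, and this makes the eigenvector of a
chain orthogonal to itself (\<open>normal_operator_no_Jordan_chain\<close>).\<close>

interpretation scaleC: vector_space "scaleC :: complex \<Rightarrow> 'a::complex_vector \<Rightarrow> 'a"
  by standard (simp_all add: scaleC_add_right scaleC_add_left scaleC_scaleC scaleC_one)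

section \<open>Scalar products on a subspace\<close>

locale scalar_product_on =
  fixes V :: "'v::complex_vector set" and ip :: "'v \<Rightarrow> 'v \<Rightarrow> complex"
  assumes ip: "is_scalar_product V ip"
begin

lemmas scalar_product_laws = ip[unfolded is_scalar_product_def]
lemmas subspace = scalar_product_laws[THEN conjunct1]
lemmas add_right = scalar_product_laws[THEN conjunct2, THEN conjunct1, rule_format]
lemmas scale_right = scalar_product_laws[THEN conjunct2, THEN conjunct2, THEN conjunct1, rule_format]
lemmas commute =
  scalar_product_laws[THEN conjunct2, THEN conjunct2, THEN conjunct2, THEN conjunct1, rule_format]
lemmas positive =
  scalar_product_laws[THEN conjunct2, THEN conjunct2, THEN conjunct2, THEN conjunct2, rule_format]

lemma mem [simp, intro]:
  "0 \<in> V" "\<lbrakk>x \<in> V; y \<in> V\<rbrakk> \<Longrightarrow> x + y \<in> V" "x \<in> V \<Longrightarrow> c *\<^sub>C x \<in> V"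
  "\<lbrakk>x \<in> V; y \<in> V\<rbrakk> \<Longrightarrow> x - y \<in> V"
  using subspace scaleC.subspace_0 scaleC.subspace_add scaleC.subspace_scale
    scaleC.subspace_diff by blast+

lemma minus_right: "\<lbrakk>x \<in> V; y \<in> V; z \<in> V\<rbrakk> \<Longrightarrow> ip x (y - z) = ip x y - ip x z"
  using add_right[of x y "(-1) *\<^sub>C z"] scale_right[of x z "-1"] mem(3)[of z "-1"]
  by simp

lemma add_left: "\<lbrakk>x \<in> V; y \<in> V; z \<in> V\<rbrakk> \<Longrightarrow> ip (x + y) z = ip x z + ip y z"
  using add_right[of z x y] commute[of "x + y" z] commute[of x z] commute[of y z] by simp

lemma minus_left: "\<lbrakk>x \<in> V; y \<in> V; z \<in> V\<rbrakk> \<Longrightarrow> ip (x - y) z = ip x z - ip y z"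
  using minus_right[of z x y] commute[of "x - y" z] commute[of x z] commute[of y z] by simp

lemma scale_left: "\<lbrakk>x \<in> V; y \<in> V\<rbrakk> \<Longrightarrow> ip (c *\<^sub>C x) y = cnj c * ip x y"
  using scale_right[of y x c] commute[of "c *\<^sub>C x" y] commute[of x y] by simp

lemma zero_right: "x \<in> V \<Longrightarrow> ip x 0 = 0"
  using minus_right[of x 0 0] by simp

lemma nonneg: "x \<in> V \<Longrightarrow> Re (ip x x) \<ge> 0"
  using positive[of x] zero_right[of x] by (cases "x = 0") auto

lemma ip_norm_square: "x \<in> V \<Longrightarrow> (ip_norm ip x)\<^sup>2 = Re (ip x x)"
  by (simp add: ip_norm_def nonneg)

lemma self_eq: "x \<in> V \<Longrightarrow> ip x x = of_real ((ip_norm ip x)\<^sup>2)"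
  using commute[of x x] by (simp add: ip_norm_square complex_eq_iff)

text \<open>Pythagoras replaces the Cauchy--Schwarz inequality here: a vector \<open>d\<close> orthogonal to \<open>w\<close>
satisfies \<open>\<parallel>w - d\<parallel> \<ge> \<parallel>w\<parallel>\<close> and cannot approximate a nonzero \<open>w\<close>. This makes the adjoint of a
densely defined operator well defined, even when the scalar product is not complete.\<close>

lemma orthogonal_to_dense:
  assumes dense: "dense_in V ip E" and w: "w \<in> V" and orth: "\<And>x. x \<in> E \<Longrightarrow> ip x w = 0"
  shows "w = 0"
proof (rule ccontr)
  assume "w \<noteq> 0"
  then have "ip_norm ip w > 0"
    using positive[OF w] by (simp add: ip_norm_def)
  then obtain d where d: "d \<in> E" "ip_norm ip (w - d) < ip_norm ip w"
    using dense w unfolding dense_in_def by meson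
  then have dV: "d \<in> V" using dense by (auto simp: dense_in_def)
  have "ip w d = 0" using orth[OF d(1)] commute[OF w dV] by simp
  then have "Re (ip (w - d) (w - d)) = Re (ip w w) + Re (ip d d)"
    using orth[OF d(1)] w dV by (simp add: minus_left minus_right)
  then have "ip_norm ip (w - d) \<ge> ip_norm ip w"
    using nonneg[OF dV] by (simp add: ip_norm_def)
  with d(2) show False by simp
qed

lemma adj_eqI:
  assumes "dense_in V ip E" and z: "z \<in> V" and eq: "\<And>x. x \<in> E \<Longrightarrow> ip (T x) y = ip x z"
  shows "adj V ip E T y = z"
  unfolding adj_def
proof (rule the_equality)
  show "z \<in> V \<and> (\<forall>x\<in>E. ip (T x) y = ip x z)" using z eq by blast
next
  fix z' assume z': "z' \<in> V \<and> (\<forall>x\<in>E. ip (T x) y = ip x z')"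
  have "z' - z = 0"
  proof (rule orthogonal_to_dense[OF assms(1)])
    show "z' - z \<in> V" using z z' by blast
    fix x assume "x \<in> E"
    moreover from this have "x \<in> V" using assms(1) by (auto simp: dense_in_def)
    ultimately show "ip x (z' - z) = 0"
      using z z' eq by (auto simp: minus_right)
  qed
  then show "z' = z" by simp
qed

lemma adj_property:
  assumes "dense_in V ip E" "y \<in> adj_dom V ip E T"
  shows "adj V ip E T y \<in> V" and "x \<in> E \<Longrightarrow> ip (T x) y = ip x (adj V ip E T y)"
proof -
  obtain z where z: "z \<in> V" "\<And>x. x \<in> E \<Longrightarrow> ip (T x) y = ip x z"
    using assms(2) by (auto simp: adj_dom_def)
  then have "adj V ip E T y = z" using adj_eqI[OF assms(1)] by blast
  with z show "adj V ip E T y \<in> V" "x \<in> E \<Longrightarrow> ip (T x) y = ip x (adj V ip E T y)" by auto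
qed

text \<open>For a normal operator an eigenvector \<open>y\<close> for \<open>l\<close> is an eigenvector of the adjoint for
  \<open>cnj l\<close>: expanding the square and using \<open>\<parallel>T\<^sup>* y\<parallel> = \<parallel>T y\<parallel> = \<bar>l\<bar> \<parallel>y\<parallel>\<close> gives
  \<open>\<parallel>T\<^sup>* y - cnj l y\<parallel> = 0\<close>.  Hence \<open>y\<close> is orthogonal to the range of \<open>T - l\<close>, so a \<open>y\<close> in
  that range is orthogonal to itself.\<close>

lemma normal_operator_no_Jordan_chain:
  assumes normal: "normal_operator V ip E T"
    and x: "x \<in> E" and y: "y \<in> E" and Tx: "T x = l *\<^sub>C x + y" and Ty: "T y = l *\<^sub>C y"
  shows "y = 0"
proof -
  have dense: "dense_in V ip E" and dom: "adj_dom V ip E T = E"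
    using normal by (auto simp: normal_operator_def densely_defined_operator_def)
  have xV: "x \<in> V" and yV: "y \<in> V" using dense x y by (auto simp: dense_in_def)
  define z where "z = adj V ip E T y"
  have z: "z \<in> V" and zip: "\<And>u. u \<in> E \<Longrightarrow> ip (T u) y = ip u z"
    using adj_property[OF dense, of y T] y dom by (auto simp: z_def)
  have "ip_norm ip (l *\<^sub>C y) = ip_norm ip z"
    using normal y Ty by (auto simp: normal_operator_def z_def)
  then have "ip z z = ip (l *\<^sub>C y) (l *\<^sub>C y)"
    using z yV by (simp add: self_eq)
  then have zz: "ip z z = cnj l * l * ip y y"
    using yV by (simp add: scale_left scale_right)
  have yz: "ip y z = cnj l * ip y y"
    using zip[OF y] Ty yV by (simp add: scale_left)
  have zy: "ip z y = l * ip y y"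
    using yz commute[OF z yV] commute[OF yV yV] by simp
  have "ip (z - cnj l *\<^sub>C y) (z - cnj l *\<^sub>C y) = 0"
    using z yV by (simp add: minus_left minus_right scale_left scale_right zz yz zy)
  then have "z - cnj l *\<^sub>C y = 0"
    using positive[of "z - cnj l *\<^sub>C y"] z yV by fastforce
  then have "ip (T x) y = cnj l * ip x y"
    using zip[OF x] xV yV by (simp add: scale_right)
  then have "ip y y = 0"
    using xV yV by (simp add: Tx add_left scale_left)
  then show "y = 0" using positive[OF yV] by auto
qed

end

section \<open>Complex Hilbert spaces\<close>

interpretation hilbert: scalar_product_on UNIV "cinner :: 'a::complex_hilbert \<Rightarrow> 'a \<Rightarrow> complex"
proof
  show "is_scalar_product UNIV (cinner :: 'a \<Rightarrow> 'a \<Rightarrow> complex)"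
    unfolding is_scalar_product_def
  proof (intro conjI ballI allI impI)
    show "cinner x y = cnj (cinner y x)" for x y :: 'a by (rule cinner_commute)
    show "Re (cinner x x) > 0" if "x \<noteq> 0" for x :: 'a
      using that by (simp add: cinner_self)
  qed (simp_all only: scaleC.subspace_UNIV cinner_add_right cinner_scaleC_right)
qed

lemmas cinner_simps =
  hilbert.add_right[simplified] hilbert.add_left[simplified]
  hilbert.minus_right[simplified] hilbert.minus_left[simplified]
  hilbert.scale_right[simplified] hilbert.scale_left[simplified]

lemma ip_norm_cinner [simp]: "ip_norm cinner x = norm x"
  by (simp add: ip_norm_def cinner_self)

lemma cinner_zero [simp]: "cinner x 0 = 0" "cinner 0 x = 0"
  using cinner_simps(3)[of x 0 0] cinner_simps(4)[of 0 0 x] by simp_all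

lemma cinner_sum_right: "cinner x (\<Sum>k\<in>S. f k) = (\<Sum>k\<in>S. cinner x (f k))"
  by (induction S rule: infinite_finite_induct) (auto simp: cinner_simps)

lemma cinner_scaleR: "cinner x (r *\<^sub>R y) = of_real r * cinner x y"
  "cinner (r *\<^sub>R x) y = of_real r * cinner x y"
  by (simp_all add: scaleR_scaleC cinner_simps)

lemma norm_scaleC: "norm (c *\<^sub>C x) = cmod c * norm (x :: 'a::complex_hilbert)"
proof -
  have "complex_of_real ((norm (c *\<^sub>C x))\<^sup>2) = (cnj c * c) * cinner x x"
    unfolding cinner_self[symmetric] by (simp add: cinner_simps)
  also have "\<dots> = of_real ((cmod c)\<^sup>2) * of_real ((norm x)\<^sup>2)"
    by (simp only: cinner_self complex_norm_square mult.commute)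
  also have "\<dots> = of_real ((cmod c * norm x)\<^sup>2)"
    by (simp add: power_mult_distrib)
  finally have "(norm (c *\<^sub>C x))\<^sup>2 = (cmod c * norm x)\<^sup>2"
    by (simp only: of_real_eq_iff)
  then show ?thesis by (rule power2_eq_imp_eq) auto
qed

lemma norm_add_square: "(norm (x + y :: 'a::complex_hilbert))\<^sup>2
    = (norm x)\<^sup>2 + (norm y)\<^sup>2 + 2 * Re (cinner x y)"
proof -
  have "Re (cinner (x + y) (x + y)) = Re (cinner x x) + Re (cinner y y) + 2 * Re (cinner x y)"
    using cinner_commute[of y x] by (simp add: cinner_simps)
  then show ?thesis by (simp add: cinner_self)
qed

text \<open>Since \<open>norm\<close> is already known to be a norm, the Cauchy--Schwarz inequality is a consequence
  of the triangle inequality.\<close>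

lemma Cauchy_Schwarz: "cmod (cinner x y) \<le> norm x * norm (y :: 'a::complex_hilbert)"
proof (cases "cinner x y = 0")
  case False
  define c where "c = cnj (cinner x y) / cmod (cinner x y)"
  have c: "cmod c = 1" using False by (simp add: c_def norm_divide)
  have "Re (cinner x (c *\<^sub>C y)) = cmod (cinner x y)"
    using False by (simp add: cinner_simps c_def complex_norm_square[symmetric] mult.commute power2_eq_square)
  moreover have "(norm (x + c *\<^sub>C y))\<^sup>2 \<le> (norm x + norm (c *\<^sub>C y))\<^sup>2"
    by (intro power_mono norm_triangle_ineq) auto
  ultimately show ?thesis
    by (simp add: norm_add_square norm_scaleC c power2_sum)
qed simp

lemma bounded_linear_cinner_right: "bounded_linear (cinner (x :: 'a::complex_hilbert))"
  by (rule bounded_linear_intro[where K = "norm x"])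
    (auto simp: cinner_simps cinner_scaleR scaleR_conv_of_real mult.commute
      intro: order.trans[OF Cauchy_Schwarz])

section \<open>Complete orthonormal sequences\<close>

locale complete_orthonormal_sequence =
  fixes \<phi> :: "nat \<Rightarrow> 'a::complex_hilbert"
  assumes orthonormal: "orthonormal cinner \<phi>" and complete: "complete_in UNIV cinner \<phi>"
begin

lemma cinner_basis: "cinner (\<phi> m) (\<phi> n) = (if m = n then 1 else 0)"
  using orthonormal by (auto simp: orthonormal_def)

lemma norm_basis: "norm (\<phi> n) = 1"
  using cinner_self[of "\<phi> n"] cinner_basis[of n n]
  by (metis norm_ge_zero of_real_eq_1_iff power2_eq_1_iff neg_0_le_iff_le not_one_le_zero)

definition partial :: "(nat \<Rightarrow> complex) \<Rightarrow> nat \<Rightarrow> 'a"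
  where "partial c N = (\<Sum>n<N. c n *\<^sub>C \<phi> n)"

lemma cinner_partial: "cinner (\<phi> m) (partial c N) = (if m < N then c m else 0)"
proof -
  have "cinner (\<phi> m) (partial c N) = (\<Sum>n<N. if m = n then c n else 0)"
    by (simp add: partial_def cinner_sum_right cinner_simps cinner_basis if_distrib cong: if_cong)
  then show ?thesis by simp
qed

lemma norm_block_square:
  assumes "finite S"
  shows "(norm (\<Sum>n\<in>S. c n *\<^sub>C \<phi> n))\<^sup>2 = (\<Sum>n\<in>S. (cmod (c n))\<^sup>2)"
  using assms
proof (induction S rule: finite_induct)
  case (insert n S)
  have "cinner (\<phi> n) (\<Sum>k\<in>S. c k *\<^sub>C \<phi> k) = (\<Sum>k\<in>S. if n = k then c k else 0)"
    by (simp add: cinner_sum_right cinner_simps cinner_basis if_distrib cong: if_cong)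
  also have "\<dots> = 0" using insert by simp
  finally show ?case
    using insert by (simp add: norm_add_square norm_scaleC norm_basis cinner_simps)
qed simp

abbreviation coord :: "'a \<Rightarrow> nat \<Rightarrow> complex"
  where "coord x n \<equiv> cinner (\<phi> n) x"

lemma partial_orthogonal: "cinner (partial (coord x) N) (x - partial (coord x) N) = 0"
proof -
  have "cinner (x - partial (coord x) N) (partial (coord x) N) = 0"
  proof -
    have "cinner (x - partial (coord x) N) (\<phi> n) = 0" if "n < N" for n
      using that cinner_commute[of "x - partial (coord x) N" "\<phi> n"]
      by (simp add: cinner_simps cinner_partial)
    then show ?thesis
      by (subst (2) partial_def) (simp add: cinner_sum_right cinner_simps(5))
  qed
  then show ?thesis using cinner_commute by (metis complex_cnj_zero)
qed

lemma norm_partial_le: "norm (partial (coord x) N) \<le> norm x"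
proof -
  have "(norm (partial (coord x) N))\<^sup>2 \<le> (norm x)\<^sup>2"
    using norm_add_square[of "partial (coord x) N" "x - partial (coord x) N"]
    by (simp add: partial_orthogonal)
  then show ?thesis by (rule power2_le_imp_le) simp
qed

lemma summable_coord: "summable (\<lambda>n. (cmod (coord x n))\<^sup>2)"
proof (rule summableI_nonneg_bounded[where x = "(norm x)\<^sup>2"])
  show "(\<Sum>n<N. (cmod (coord x n))\<^sup>2) \<le> (norm x)\<^sup>2" for N
    using norm_partial_le[of x N] norm_block_square[of "{..<N}" "coord x"]
    by (simp add: partial_def power_mono flip: norm_block_square)
qed auto

lemma partial_diff: "partial (coord (x - y)) N = partial (coord x) N - partial (coord y) N"
  by (simp add: partial_def cinner_simps scaleC.scale_left_diff_distrib sum_subtractf)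

text \<open>The partial sums of the expansion are contractions and eventually reproduce every finite linear
combination of the basis. As these combinations are dense, the expansion of every vector converges
to it.\<close>

lemma span_eventually_partial:
  assumes "d \<in> cspan (range \<phi>)"
  shows "\<exists>N. \<forall>n\<ge>N. partial (coord d) n = d"
proof -
  have eq: "partial (coord (\<phi> m)) n = \<phi> m" if "n > m" for m n
  proof -
    have "partial (coord (\<phi> m)) n = (\<Sum>k<n. if k = m then \<phi> k else 0)"
      unfolding partial_def by (intro sum.cong) (auto simp: cinner_basis)
    then show ?thesis using that by simp
  qed
  show ?thesis
    using assms
  proof (induction rule: scaleC.span_induct_alt)
    case base
    show ?case by (simp add: partial_def)
  next
    case (step c x y)
    from step(1) obtain m where m: "x = \<phi> m" by blast
    from step(2) obtain N where N: "\<forall>n\<ge>N. partial (coord y) n = y" by blast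
    have "partial (coord (c *\<^sub>C x + y)) n = c *\<^sub>C x + y" if "n \<ge> max N (Suc m)" for n
    proof -
      have "partial (coord (c *\<^sub>C x + y)) n = c *\<^sub>C partial (coord x) n + partial (coord y) n"
        by (simp add: partial_def cinner_simps scaleC_add_left sum.distrib
            scaleC.scale_sum_right scaleC_scaleC)
      then show ?thesis using N that by (simp add: m eq)
    qed
    then show ?case by blast
  qed
qed

lemma partial_tendsto: "partial (coord x) \<longlonglongrightarrow> x"
proof (rule metric_LIMSEQ_I)
  fix e :: real assume "e > 0"
  then obtain d where d: "d \<in> cspan (range \<phi>)" "norm (x - d) < e / 2"
    using complete half_gt_zero[of e] unfolding complete_in_def dense_in_def ip_norm_cinner
    by (meson UNIV_I)
  obtain N where N: "\<forall>n\<ge>N. partial (coord d) n = d"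
    using span_eventually_partial[OF d(1)] by blast
  have "dist (partial (coord x) n) x < e" if "n \<ge> N" for n
  proof -
    have "partial (coord x) n - x = partial (coord (x - d)) n - (x - d)"
      using N that by (simp add: partial_diff)
    also have "norm \<dots> \<le> norm (x - d) + norm (x - d)"
      by (rule order.trans[OF norm_triangle_ineq4]) (simp add: norm_partial_le)
    finally show ?thesis using d(2) by (simp add: dist_norm)
  qed
  then show "\<exists>N. \<forall>n\<ge>N. dist (partial (coord x) n) x < e" by blast
qed

lemma eq_if_coord_eq:
  assumes "\<And>n. coord x n = coord y n"
  shows "x = y"
proof -
  have "partial (coord x) = partial (coord y)" by (simp add: assms)
  with partial_tendsto[of x] have "partial (coord y) \<longlonglongrightarrow> x" by metis
  then show ?thesis using partial_tendsto[of y] by (rule LIMSEQ_unique)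
qed

lemma Parseval: "(\<lambda>n. cnj (coord x n) * coord y n) sums cinner x y"
proof -
  have "(\<lambda>N. cinner x (partial (coord y) N)) \<longlonglongrightarrow> cinner x y"
    by (rule bounded_linear.tendsto[OF bounded_linear_cinner_right partial_tendsto])
  moreover have "cinner x (partial (coord y) N) = (\<Sum>n<N. cnj (coord x n) * coord y n)" for N
    unfolding partial_def cinner_sum_right cinner_simps
    using cinner_commute[of x] by (intro sum.cong) (auto simp: mult.commute)
  ultimately show ?thesis by (simp add: sums_def)
qed

lemma Parseval_norm: "(\<lambda>n. (cmod (coord x n))\<^sup>2) sums (norm x)\<^sup>2"
proof -
  have "(\<lambda>n. complex_of_real ((cmod (coord x n))\<^sup>2)) sums of_real ((norm x)\<^sup>2)"
    using Parseval[of x x] by (simp only: complex_norm_square cinner_self mult.commute)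
  then show ?thesis by (simp only: sums_of_real_iff)
qed

text \<open>By Pythagoras the square of the norm of a block of the series is the corresponding block of the
convergent series of squares, so the partial sums form a Cauchy sequence.\<close>

lemma Riesz_Fischer:
  assumes "summable (\<lambda>n. (cmod (c n))\<^sup>2)"
  shows "coord (\<Sum>n. c n *\<^sub>C \<phi> n) m = c m"
proof -
  have "summable (\<lambda>n. c n *\<^sub>C \<phi> n)"
  proof (subst summable_Cauchy, intro allI impI)
    fix e :: real assume e: "e > 0"
    then obtain N where N: "\<forall>m\<ge>N. \<forall>n. norm (\<Sum>k = m..<n. (cmod (c k))\<^sup>2) < e\<^sup>2"
      using assms unfolding summable_Cauchy by (meson zero_less_power)
    have "norm (\<Sum>k = m..<n. c k *\<^sub>C \<phi> k) < e" if "m \<ge> N" for m n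
    proof -
      have "(norm (\<Sum>k = m..<n. c k *\<^sub>C \<phi> k))\<^sup>2 < e\<^sup>2"
        using N that by (simp add: norm_block_square abs_less_iff)
      then show ?thesis using e by (simp add: power2_less_imp_less)
    qed
    then show "\<exists>N. \<forall>m\<ge>N. \<forall>n. norm (\<Sum>k = m..<n. c k *\<^sub>C \<phi> k) < e" by blast
  qed
  then have "partial c \<longlonglongrightarrow> (\<Sum>n. c n *\<^sub>C \<phi> n)"
    by (simp add: partial_def[abs_def] summable_LIMSEQ)
  from bounded_linear.tendsto[OF bounded_linear_cinner_right this]
  have "(\<lambda>N. coord (partial c N) m) \<longlonglongrightarrow> coord (\<Sum>n. c n *\<^sub>C \<phi> n) m" .
  moreover have "(\<lambda>N. coord (partial c N) m) \<longlonglongrightarrow> c m"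
    by (rule tendsto_eventually, rule eventually_sequentiallyI[of "Suc m"])
      (simp add: cinner_partial)
  ultimately show ?thesis by (rule LIMSEQ_unique)
qed

end

section \<open>A self-adjoint operator with an orthonormal basis of eigenvectors\<close>

locale diagonal_self_adjoint = complete_orthonormal_sequence \<phi>
  for \<phi> :: "nat \<Rightarrow> 'a::complex_hilbert" +
  fixes D :: "'a set" and L :: "'a \<Rightarrow> 'a" and \<mu> :: "nat \<Rightarrow> real"
  assumes self_adjoint: "self_adjoint UNIV cinner D L"
    and eigen: "\<phi> n \<in> D" "L (\<phi> n) = \<mu> n *\<^sub>R \<phi> n"
begin

lemma dense: "dense_in UNIV cinner D" and adj_dom: "adj_dom UNIV cinner D L = D"
  and adj_eq: "x \<in> D \<Longrightarrow> adj UNIV cinner D L x = L x" and csubspace_D: "csubspace D"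
  using self_adjoint by (auto simp: self_adjoint_def densely_defined_operator_def)

lemma coord_L:
  assumes "x \<in> D"
  shows "coord (L x) n = \<mu> n * coord x n"
proof -
  have "x \<in> adj_dom UNIV cinner D L" using assms by (simp only: adj_dom)
  from hilbert.adj_property(2)[OF dense this eigen(1)[of n]]
  have "cinner (L (\<phi> n)) x = coord (L x) n" by (simp only: adj_eq[OF assms])
  then show ?thesis by (simp add: eigen(2) cinner_scaleR)
qed

text \<open>If \<open>\<mu> n * coord y n\<close> is square summable, it is the coordinate sequence of some \<open>z\<close>, and Parseval's
identity gives \<open>\<langle>L x, y\<rangle> = \<langle>x, z\<rangle>\<close> for all \<open>x\<close> in the domain. So \<open>y\<close> lies in the domain of the
adjoint, which is \<open>D\<close>: a self-adjoint operator is already the maximal diagonal operator.\<close>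

lemma domain_eq: "D = {x. summable (\<lambda>n. (cmod (\<mu> n * coord x n))\<^sup>2)}"
proof (intro equalityI subsetI CollectI)
  show "summable (\<lambda>n. (cmod (\<mu> n * coord x n))\<^sup>2)" if "x \<in> D" for x
    using summable_coord[of "L x"] that by (simp add: coord_L)
next
  fix y assume "y \<in> {x. summable (\<lambda>n. (cmod (\<mu> n * coord x n))\<^sup>2)}"
  then have "summable (\<lambda>n. (cmod (\<mu> n * coord y n))\<^sup>2)" by simp
  then have z: "coord (\<Sum>n. (\<mu> n * coord y n) *\<^sub>C \<phi> n) m = \<mu> m * coord y m" for m
    by (rule Riesz_Fischer)
  have "cinner (L x) y = cinner x (\<Sum>n. (\<mu> n * coord y n) *\<^sub>C \<phi> n)" if "x \<in> D" for x
  proof -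
    have "cnj (coord (L x) n) * coord y n
        = cnj (coord x n) * coord (\<Sum>n. (\<mu> n * coord y n) *\<^sub>C \<phi> n) n" for n
      using that by (simp add: coord_L z mult_ac)
    then show ?thesis
      using Parseval[of "L x" y] Parseval[of x "\<Sum>n. (\<mu> n * coord y n) *\<^sub>C \<phi> n"]
      by (simp only: sums_unique2)
  qed
  then have "y \<in> adj_dom UNIV cinner D L" unfolding adj_dom_def by blast
  then show "y \<in> D" by (simp add: adj_dom)
qed

end

section \<open>Operators that are diagonal in square-summable coordinates\<close>

definition hdot :: "complex^'j \<Rightarrow> complex^'j \<Rightarrow> complex"
  where "hdot x y = (\<Sum>j\<in>UNIV. cnj (x $ j) * y $ j)"

lemma norm_square_cart: "(norm (x :: complex^'j::finite))\<^sup>2 = (\<Sum>j\<in>UNIV. (cmod (x $ j))\<^sup>2)"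
  by (simp add: norm_vec_def L2_set_def sum_nonneg)

lemma hdot_self: "hdot x x = complex_of_real ((norm (x :: complex^'j::finite))\<^sup>2)"
  unfolding hdot_def norm_square_cart of_real_sum
  by (simp only: complex_norm_square mult.commute)

lemma hdot_right: "hdot x (y + z) = hdot x y + hdot x z" "hdot x (c *s y) = c * hdot x y"
  by (simp_all add: hdot_def distrib_left sum.distrib sum_distrib_left mult_ac)

lemma hdot_commute: "hdot x y = cnj (hdot y x)"
  by (simp add: hdot_def mult.commute)

lemma hdot_axis: "hdot (axis j 1) x = x $ j"
  by (simp add: hdot_def axis_def if_distrib[of "\<lambda>t. cnj t * _"] cong: if_cong)

lemma norm_hdot_le: "cmod (hdot x y) \<le> (norm (x :: complex^'j::finite))\<^sup>2 + (norm y)\<^sup>2"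
proof -
  have le: "cmod (cnj u * v) \<le> (cmod u)\<^sup>2 + (cmod v)\<^sup>2" for u v :: complex
  proof -
    have "2 * (cmod u * cmod v) \<le> (cmod u)\<^sup>2 + (cmod v)\<^sup>2"
      using sum_squares_bound[of "cmod u" "cmod v"] by (simp add: mult.assoc)
    moreover have "0 \<le> cmod u * cmod v" by simp
    ultimately show ?thesis unfolding norm_mult complex_mod_cnj by linarith
  qed
  have "cmod (hdot x y) \<le> (\<Sum>j\<in>UNIV. (cmod (x $ j))\<^sup>2 + (cmod (y $ j))\<^sup>2)"
    unfolding hdot_def by (rule sum_norm_le) (rule le)
  then show ?thesis by (simp add: norm_square_cart sum.distrib)
qed

text \<open>The map \<open>a\<close> identifies \<open>V\<close> with the space of square-summable families indexed by \<open>nat \<times> 'j\<close>, and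
\<open>e\<close> consists of the preimages of the unit families. The index is kept as a pair because the phase
spaces split into blocks of dimension three, over which the scalar products are summed.\<close>

locale square_summable_coordinates =
  fixes V :: "'v::complex_vector set"
    and a :: "'v \<Rightarrow> nat \<Rightarrow> complex^'j::finite"
    and e :: "nat \<times> 'j \<Rightarrow> 'v"
  assumes V: "csubspace V"
    and a_add: "a (x + y) n = a x n + a y n"
    and a_scale: "a (c *\<^sub>C x) n = c *s a x n"
    and a_summable: "x \<in> V \<Longrightarrow> summable (\<lambda>n. (norm (a x n))\<^sup>2)"
    and a_surj: "summable (\<lambda>n. (norm (s n))\<^sup>2) \<Longrightarrow> \<exists>x\<in>V. \<forall>n. a x n = s n"
    and a_inj: "\<lbrakk>x \<in> V; \<And>n. a x n = 0\<rbrakk> \<Longrightarrow> x = 0"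
    and e_mem: "e k \<in> V"
    and a_e: "a (e (n, j)) m = (if m = n then axis j 1 else 0)"
begin

definition ip :: "'v \<Rightarrow> 'v \<Rightarrow> complex"
  where "ip x y = (\<Sum>n. hdot (a x n) (a y n))"

lemma a_zero: "a 0 n = 0"
  using a_add[of 0 0 n] by simp

lemma a_minus: "a (x - y) n = a x n - a y n"
  using a_add[of "x - y" y n] by simp

lemma a_sum: "a (\<Sum>k\<in>S. f k) n = (\<Sum>k\<in>S. a (f k) n)"
  by (induction S rule: infinite_finite_induct) (auto simp: a_add a_zero)

lemma summable_hdot: "\<lbrakk>x \<in> V; y \<in> V\<rbrakk> \<Longrightarrow> summable (\<lambda>n. hdot (a x n) (a y n))"
  using summable_add[OF a_summable a_summable, of x y]
  by (rule summable_comparison_test'[where N = 0]) (auto intro: norm_hdot_le)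

lemma ip_self: "x \<in> V \<Longrightarrow> ip x x = of_real (\<Sum>n. (norm (a x n))\<^sup>2)"
  unfolding ip_def hdot_self by (rule suminf_of_real[symmetric, OF a_summable])

lemma ip_norm_eq: "x \<in> V \<Longrightarrow> ip_norm ip x = sqrt (\<Sum>n. (norm (a x n))\<^sup>2)"
  by (simp add: ip_norm_def ip_self)

lemma is_scalar_product: "is_scalar_product V ip"
  unfolding is_scalar_product_def
proof (intro conjI ballI allI impI)
  fix x y z :: 'v and c :: complex
  assume x: "x \<in> V"
  show "ip x (y + z) = ip x y + ip x z" if "y \<in> V" "z \<in> V"
    using x that by (simp add: ip_def a_add hdot_right suminf_add summable_hdot)
  show "ip x (c *\<^sub>C y) = c * ip x y" if "y \<in> V"
    using x that by (simp add: ip_def a_scale hdot_right suminf_mult summable_hdot)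
  show "ip x y = cnj (ip y x)" if "y \<in> V"
  proof -
    have "(\<lambda>n. hdot (a y n) (a x n)) sums ip y x"
      using summable_sums[OF summable_hdot[OF that x]] by (simp only: ip_def)
    then have "(\<lambda>n. cnj (hdot (a y n) (a x n))) sums cnj (ip y x)"
      by (simp only: sums_cnj)
    moreover have "cnj (hdot (a y n) (a x n)) = hdot (a x n) (a y n)" for n
      by (rule hdot_commute[symmetric])
    ultimately show ?thesis unfolding ip_def[of x] by (simp only: sums_iff)
  qed
  show "Re (ip x x) > 0" if nonzero: "x \<noteq> 0"
  proof -
    obtain n where "a x n \<noteq> 0" using a_inj[OF x] nonzero by blast
    then have "0 < (\<Sum>n. (norm (a x n))\<^sup>2)"
      by (intro suminf_pos2[of _ n] a_summable x) auto
    then show ?thesis by (simp add: ip_self[OF x])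
  qed
qed (rule V)

sublocale scalar_product_on V ip
  by unfold_locales (rule is_scalar_product)

lemma a_eqI: "\<lbrakk>x \<in> V; y \<in> V; \<And>n. a x n = a y n\<rbrakk> \<Longrightarrow> x = y"
  using a_inj[of "x - y"] by (simp add: a_minus)

lemma ip_e_left: "ip (e (n, j)) x = a x n $ j"
proof -
  have "ip (e (n, j)) x = (\<Sum>m\<in>{n}. hdot (a (e (n, j)) m) (a x m))"
    unfolding ip_def by (rule suminf_finite) (auto simp: a_e hdot_def)
  then show ?thesis by (simp add: a_e hdot_axis)
qed

lemma orthonormal_e: "orthonormal ip e"
proof -
  have "ip (e k) (e l) = (if k = l then 1 else 0)" for k l
    by (cases k; cases l) (auto simp: ip_e_left a_e axis_def)
  then show ?thesis by (simp add: orthonormal_def)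
qed

definition truncate :: "'v \<Rightarrow> nat \<Rightarrow> 'v"
  where "truncate x N = (\<Sum>n<N. \<Sum>j\<in>UNIV. a x n $ j *\<^sub>C e (n, j))"

lemma truncate_span: "truncate x N \<in> cspan (range e)"
  unfolding truncate_def
  by (intro scaleC.span_sum scaleC.span_scale scaleC.span_base rangeI)

lemma span_subset: "cspan (range e) \<subseteq> V"
  by (rule scaleC.span_minimal) (auto simp: e_mem V)

lemma a_truncate: "a (truncate x N) m = (if m < N then a x m else 0)"
proof -
  have "a (truncate x N) m = (\<Sum>n<N. \<Sum>j\<in>UNIV. a x n $ j *s (if m = n then axis j 1 else 0))"
    by (simp add: truncate_def a_sum a_scale a_e)
  also have "\<dots> = (\<Sum>n<N. if m = n then (\<Sum>j\<in>UNIV. a x n $ j *s axis j 1) else 0)"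
    by (intro sum.cong) auto
  also have "\<dots> = (if m < N then a x m else 0)"
    by (simp add: basis_expansion)
  finally show ?thesis .
qed

lemma truncate_approximates:
  assumes x: "x \<in> V" and r: "r > 0"
  shows "\<exists>N. ip_norm ip (x - truncate x N) < r"
proof -
  define f where "f n = (norm (a x n))\<^sup>2" for n
  have f: "summable f" unfolding f_def using a_summable[OF x] .
  from suminf_exist_split[OF _ f, of "r\<^sup>2"] r
  obtain N where N: "norm (\<Sum>i. f (i + N)) < r\<^sup>2" by auto
  have g: "summable (\<lambda>n. (norm (a (x - truncate x N) n))\<^sup>2)"
    using x truncate_span span_subset by (intro a_summable mem) blast+
  from suminf_split_initial_segment[OF this, of N]
  have "(\<Sum>n. (norm (a (x - truncate x N) n))\<^sup>2) = (\<Sum>i. f (i + N))"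
    by (simp add: a_minus a_truncate f_def)
  moreover have "x - truncate x N \<in> V"
    using x truncate_span span_subset by (intro mem) blast+
  ultimately have "ip_norm ip (x - truncate x N) = sqrt (\<Sum>i. f (i + N))"
    by (simp add: ip_norm_eq)
  also have "\<dots> < sqrt (r\<^sup>2)"
    using N by (intro real_sqrt_less_mono) simp
  finally have "ip_norm ip (x - truncate x N) < sqrt (r\<^sup>2)" .
  then show ?thesis using r by auto
qed

lemma dense_span: "dense_in V ip (cspan (range e))"
  unfolding dense_in_def using truncate_span truncate_approximates span_subset by meson

end

text \<open>A diagonal operator on its maximal domain. It is normal because multiplication by \<open>lam\<close> and by its
complex conjugate have the same domain and the same norm, and the second one is the adjoint: pairing
with the unit vectors \<open>e\<close> already determines the coordinates of the adjoint.\<close>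

locale diagonal_operator = square_summable_coordinates V a e
  for V :: "'v::complex_vector set" and a :: "'v \<Rightarrow> nat \<Rightarrow> complex^'j::finite" and e +
  fixes E :: "'v set" and T :: "'v \<Rightarrow> 'v" and lam :: "nat \<Rightarrow> 'j \<Rightarrow> complex"
  assumes E_iff: "x \<in> E \<longleftrightarrow> x \<in> V \<and> summable (\<lambda>n. (norm (\<chi> j. lam n j * a x n $ j))\<^sup>2)"
    and T_mem: "x \<in> E \<Longrightarrow> T x \<in> V"
    and a_T: "x \<in> E \<Longrightarrow> a (T x) n = (\<chi> j. lam n j * a x n $ j)"
begin

lemma E_V: "x \<in> E \<Longrightarrow> x \<in> V" by (simp add: E_iff)

lemma mem_E_iff: "x \<in> E \<longleftrightarrow> x \<in> V \<and> (\<exists>z\<in>V. \<forall>n. a z n = (\<chi> j. lam n j * a x n $ j))"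
proof
  assume "x \<in> E"
  then show "x \<in> V \<and> (\<exists>z\<in>V. \<forall>n. a z n = (\<chi> j. lam n j * a x n $ j))"
    using T_mem a_T E_V by blast
next
  assume "x \<in> V \<and> (\<exists>z\<in>V. \<forall>n. a z n = (\<chi> j. lam n j * a x n $ j))"
  then show "x \<in> E" using a_summable by (force simp: E_iff)
qed

lemma subspace_E: "csubspace E"
proof (rule scaleC.subspaceI)
  show "0 \<in> E"
    unfolding mem_E_iff by (auto simp: a_zero vec_eq_iff intro!: bexI[of _ 0])
  show "x + y \<in> E" if "x \<in> E" "y \<in> E" for x y
    using that T_mem a_T unfolding mem_E_iff[of "x + y"]
    by (auto simp: E_V a_add vec_eq_iff distrib_left intro!: bexI[of _ "T x + T y"])
  show "c *\<^sub>C x \<in> E" if "x \<in> E" for c x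
    using that T_mem a_T unfolding mem_E_iff[of "c *\<^sub>C x"]
    by (auto simp: E_V a_scale vec_eq_iff intro!: bexI[of _ "c *\<^sub>C T x"])
qed

lemma T_add: "\<lbrakk>x \<in> E; y \<in> E\<rbrakk> \<Longrightarrow> T (x + y) = T x + T y"
  using scaleC.subspace_add[OF subspace_E]
  by (intro a_eqI mem T_mem) (auto simp: a_T a_add vec_eq_iff distrib_left)

lemma T_scale: "x \<in> E \<Longrightarrow> T (c *\<^sub>C x) = c *\<^sub>C T x"
  using scaleC.subspace_scale[OF subspace_E]
  by (intro a_eqI mem T_mem) (auto simp: a_T a_scale vec_eq_iff)

lemma e_in_E: "e k \<in> E"
proof -
  obtain n i where k: "k = (n, i)" by (cases k)
  have "summable (\<lambda>m. (norm (\<chi> j. lam m j * a (e k) m $ j))\<^sup>2)"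
    by (rule summable_finite[of "{n}"]) (auto simp: k a_e norm_square_cart)
  then show ?thesis by (simp add: E_iff e_mem)
qed

lemma T_e: "T (e (n, j)) = lam n j *\<^sub>C e (n, j)"
  by (intro a_eqI mem T_mem e_in_E e_mem)
    (auto simp: a_T[OF e_in_E] a_scale a_e vec_eq_iff axis_def)

lemma dense_E: "dense_in V ip E"
proof -
  have "cspan (range e) \<subseteq> E"
    using subspace_E e_in_E by (intro scaleC.span_minimal) auto
  then show ?thesis
    using dense_span E_V unfolding dense_in_def by (meson subsetD subsetI)
qed

lemma adjoint_identity:
  assumes z: "\<And>n. a z n = (\<chi> j. cnj (lam n j) * a y n $ j)" and x: "x \<in> E"
  shows "ip (T x) y = ip x z"
proof -
  have "hdot (a (T x) n) (a y n) = hdot (a x n) (a z n)" for n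
    by (simp add: a_T x z hdot_def mult_ac)
  then show ?thesis by (simp add: ip_def)
qed

lemma norm_cnj_lam: "norm (\<chi> j. cnj (lam n j) * v $ j) = norm (\<chi> j. lam n j * v $ j)"
  by (simp add: norm_vec_def norm_mult)

lemma adjoint_exists:
  assumes "y \<in> E"
  shows "\<exists>z\<in>V. \<forall>n. a z n = (\<chi> j. cnj (lam n j) * a y n $ j)"
  using assms by (intro a_surj) (simp add: norm_cnj_lam E_iff)

lemma adj_dom: "adj_dom V ip E T = E"
proof (intro equalityI subsetI)
  fix y assume "y \<in> E"
  then show "y \<in> adj_dom V ip E T"
    using adjoint_exists[of y] adjoint_identity E_V unfolding adj_dom_def by blast
next
  fix y assume "y \<in> adj_dom V ip E T"
  then obtain z where y: "y \<in> V" and z: "z \<in> V" "\<And>x. x \<in> E \<Longrightarrow> ip (T x) y = ip x z"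
    unfolding adj_dom_def by blast
  have "a z n $ j = cnj (lam n j) * a y n $ j" for n j
    using z(2)[OF e_in_E, of "(n, j)"] scale_left[OF e_mem y]
    by (simp add: T_e ip_e_left)
  then have "a z n = (\<chi> j. cnj (lam n j) * a y n $ j)" for n
    by (simp add: vec_eq_iff)
  then show "y \<in> E" using a_summable[OF z(1)] by (simp add: E_iff y norm_cnj_lam)
qed

theorem normal: "normal_operator V ip E T"
  unfolding normal_operator_def densely_defined_operator_def
proof (intro conjI ballI allI)
  fix x assume x: "x \<in> E"
  obtain z where z: "z \<in> V" "\<And>n. a z n = (\<chi> j. cnj (lam n j) * a x n $ j)"
    using adjoint_exists[OF x] by blast
  have "adj V ip E T x = z"
    by (rule adj_eqI[OF dense_E z(1)]) (rule adjoint_identity[OF z(2)])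
  then show "ip_norm ip (T x) = ip_norm ip (adj V ip E T x)"
    by (simp add: ip_norm_eq z T_mem[OF x] a_T[OF x] norm_cnj_lam)
qed (auto simp: subspace_E dense_E T_mem T_add T_scale adj_dom)

end

section \<open>The characteristic cubic\<close>

text \<open>An identity between values at every \<open>l\<close>: it can be evaluated at a given root, and it is visibly
symmetric in \<open>x\<close>, \<open>y\<close> and \<open>z\<close>.\<close>

definition factors_cubic ::
  "real \<Rightarrow> real \<Rightarrow> real \<Rightarrow> complex \<Rightarrow> complex \<Rightarrow> complex \<Rightarrow> bool" where
  "factors_cubic \<alpha> \<beta> m x y z \<longleftrightarrow>
     (\<forall>l. of_real \<alpha> * l ^ 3 + l\<^sup>2 + of_real (\<beta> * m) * l + of_real m =
        of_real \<alpha> * ((l - x) * (l - y) * (l - z)))"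

lemma factors_cubic_swap:
  "factors_cubic \<alpha> \<beta> m x y z \<Longrightarrow> factors_cubic \<alpha> \<beta> m y x z"
  "factors_cubic \<alpha> \<beta> m x y z \<Longrightarrow> factors_cubic \<alpha> \<beta> m x z y"
  by (simp_all add: factors_cubic_def mult_ac)

lemma characteristic_roots_factors:
  assumes "characteristic_roots \<alpha> \<beta> \<mu> \<rho>"
  shows "factors_cubic \<alpha> \<beta> (\<mu> n) (\<rho> n 1) (\<rho> n 2) (\<rho> n 3)"
  unfolding factors_cubic_def
proof
  fix l :: complex
  have "of_real \<alpha> * l ^ 3 + l\<^sup>2 + of_real (\<beta> * \<mu> n) * l + of_real (\<mu> n) =
      poly [:of_real (\<mu> n), of_real (\<beta> * \<mu> n), 1, of_real \<alpha>:] l"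
    unfolding poly_pCons poly_0 by algebra
  also have "\<dots> = poly (smult (of_real \<alpha>) (\<Prod>j\<in>UNIV. [:- \<rho> n j, 1:])) l"
    by (rule arg_cong[OF spec[OF assms[unfolded characteristic_roots_def]]])
  also have "\<dots> = of_real \<alpha> * (\<Prod>j\<in>UNIV. l - \<rho> n j)"
    by (simp add: poly_prod)
  also have "(\<Prod>j\<in>UNIV. l - \<rho> n j) = (l - \<rho> n 1) * (l - \<rho> n 2) * (l - \<rho> n 3)"
    unfolding UNIV_3 by (simp add: mult.assoc)
  finally show "of_real \<alpha> * l ^ 3 + l\<^sup>2 + of_real (\<beta> * \<mu> n) * l + of_real (\<mu> n) =
      of_real \<alpha> * ((l - \<rho> n 1) * (l - \<rho> n 2) * (l - \<rho> n 3))" .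
qed

lemma root_of_cubic:
  assumes "factors_cubic \<alpha> \<beta> m x y z" and "l \<in> {x, y, z}"
  shows "of_real \<alpha> * l ^ 3 + l\<^sup>2 + of_real (\<beta> * m) * l + of_real m = 0"
proof -
  have "(l - x) * (l - y) * (l - z) = 0" using assms(2) by auto
  then show ?thesis using assms(1) by (simp add: factors_cubic_def del: mult_eq_0_iff)
qed

lemma Vieta:
  assumes "factors_cubic \<alpha> \<beta> m x y z"
  shows "of_real \<alpha> * (x + y + z) = -1"
    and "of_real \<alpha> * (x * y + x * z + y * z) = of_real (\<beta> * m)"
    and "of_real \<alpha> * (x * y * z) = - of_real m"
proof -
  define a c d where "a = complex_of_real \<alpha>" and "c = complex_of_real (\<beta> * m)"
    and "d = complex_of_real m"
  have eq: "a * l ^ 3 + l\<^sup>2 + c * l + d = a * ((l - x) * (l - y) * (l - z))" for l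
    using assms unfolding factors_cubic_def a_def c_def d_def by blast
  have 0: "d = - (a * (x * y * z))" using eq[of 0] by simp
  have 1: "a + 1 + c + d = a * ((1 - x) * (1 - y) * (1 - z))" using eq[of 1] by simp
  have 2: "- a + 1 - c + d = - (a * ((1 + x) * (1 + y) * (1 + z)))"
    using eq[of "-1"] by (simp add: algebra_simps)
  have "2 * (a * (x + y + z) + 1) = 0" using 0 1 2 by algebra
  then have "a * (x + y + z) + 1 = 0" unfolding mult_eq_0_iff by auto
  then show "of_real \<alpha> * (x + y + z) = -1" by (simp only: a_def eq_neg_iff_add_eq_0)
  have "2 * (a * (x * y + x * z + y * z) - c) = 0" using 0 1 2 by algebra
  then have "a * (x * y + x * z + y * z) - c = 0" unfolding mult_eq_0_iff by auto
  then show "of_real \<alpha> * (x * y + x * z + y * z) = of_real (\<beta> * m)"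
    by (simp only: a_def c_def right_minus_eq)
  show "of_real \<alpha> * (x * y * z) = - of_real m" using 0 by (simp add: a_def d_def)
qed

text \<open>The first equation of the calculation is the homogeneous form of the classical discriminant, with
the coefficients of the cubic written as elementary symmetric functions of its roots.\<close>

lemma discriminant_cubic:
  assumes "factors_cubic \<alpha> \<beta> m x y z"
  shows "of_real (\<alpha> ^ 4) * ((x - y) * (x - z) * (y - z))\<^sup>2 =
    of_real (- m * (4 * \<alpha> * \<beta> ^ 3 * m\<^sup>2 + (27 * \<alpha>\<^sup>2 - 18 * \<alpha> * \<beta> - \<beta>\<^sup>2) * m + 4))"
proof -
  define a b d where "a = complex_of_real \<alpha>" and "b = complex_of_real \<beta>"
    and "d = complex_of_real m"
  have v: "a * (x + y + z) = -1" "a * (x * y + x * z + y * z) = b * d" "a * (x * y * z) = - d"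
    using Vieta[OF assms] by (simp_all add: a_def b_def d_def)
  have "a ^ 4 * ((x - y) * (x - z) * (y - z))\<^sup>2 =
    (a * (x + y + z))\<^sup>2 * (a * (x * y + x * z + y * z))\<^sup>2
     - 4 * a * (a * (x * y + x * z + y * z)) ^ 3
     - 4 * (a * (x + y + z)) ^ 3 * (a * (x * y * z))
     + 18 * a * (a * (x + y + z)) * (a * (x * y + x * z + y * z)) * (a * (x * y * z))
     - 27 * a\<^sup>2 * (a * (x * y * z))\<^sup>2"
    by algebra
  also have "\<dots> = - d * (4 * a * b ^ 3 * d\<^sup>2 + (27 * a\<^sup>2 - 18 * a * b - b\<^sup>2) * d + 4)"
    unfolding v by algebra
  finally show ?thesis by (simp add: a_def b_def d_def)
qed

text \<open>The numbers \<open>m1\<close> and \<open>m2\<close> are the two zeros of the quadratic factor of the discriminant: completing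
the square in that factor gives \<open>X\<^sup>2 = C2\<close> for the affine function \<open>X\<close> of \<open>m\<close> below. The factor
\<open>- m\<close> of the discriminant does not vanish for \<open>m > 0\<close>.\<close>

lemma multiple_root_iff:
  assumes pos: "\<alpha> > 0" "\<beta> > 0" "m > 0" and cubic: "factors_cubic \<alpha> \<beta> m x y z"
  shows "(of_real m = m1 \<alpha> \<beta> \<or> of_real m = m2 \<alpha> \<beta>) \<longleftrightarrow> (x = y \<or> x = z \<or> y = z)"
proof -
  define X where "X = 8 * \<beta> ^ 3 * m / \<alpha> + C1 \<alpha> \<beta>"
  define s where "s = csqrt (of_real (C2 \<alpha> \<beta>))"
  have scale: "of_real m = of_real \<alpha> * ((- of_real (C1 \<alpha> \<beta>) + t) / of_real (8 * \<beta> ^ 3)) \<longleftrightarrow>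
      of_real X = t" for t :: complex
    using pos by (auto simp: X_def field_simps)
  have "(of_real m = m1 \<alpha> \<beta> \<or> of_real m = m2 \<alpha> \<beta>) \<longleftrightarrow> of_real X = - s \<or> of_real X = s"
    using scale[of "- s"] scale[of s] by (simp add: m1_def m2_def s_def)
  also have "\<dots> \<longleftrightarrow> (complex_of_real X)\<^sup>2 = s\<^sup>2" by (auto simp: power2_eq_iff)
  also have "\<dots> \<longleftrightarrow> X\<^sup>2 = C2 \<alpha> \<beta>"
    unfolding s_def power2_csqrt of_real_power[symmetric] of_real_eq_iff ..
  also have "X\<^sup>2 - C2 \<alpha> \<beta> = 16 * \<beta> ^ 3 / \<alpha> ^ 3 *
      (4 * \<alpha> * \<beta> ^ 3 * m\<^sup>2 + (27 * \<alpha>\<^sup>2 - 18 * \<alpha> * \<beta> - \<beta>\<^sup>2) * m + 4)"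
    using pos by (simp add: X_def C2_def C1_def field_simps power2_eq_square power3_eq_cube)
  then have "X\<^sup>2 = C2 \<alpha> \<beta> \<longleftrightarrow>
      4 * \<alpha> * \<beta> ^ 3 * m\<^sup>2 + (27 * \<alpha>\<^sup>2 - 18 * \<alpha> * \<beta> - \<beta>\<^sup>2) * m + 4 = 0"
    using pos by (simp add: eq_iff_diff_eq_0[of "X\<^sup>2"])
  also have "\<dots> \<longleftrightarrow> of_real (\<alpha> ^ 4) * ((x - y) * (x - z) * (y - z))\<^sup>2 = 0"
    unfolding discriminant_cubic[OF cubic] using pos by (simp only: of_real_eq_0_iff) simp
  also have "\<dots> \<longleftrightarrow> (x = y \<or> x = z \<or> y = z)" using pos by simp
  finally show ?thesis .
qed

text \<open>At \<open>- 2 / \<beta>\<close> the linear part \<open>m (1 + \<beta> r)\<close> equals \<open>- m\<close> and outweighs the square, while at \<open>0\<close> the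
value is \<open>m > 0\<close>. So one root stays bounded as \<open>m\<close> grows.\<close>

lemma bounded_real_root:
  assumes pos: "\<alpha> > 0" "\<beta> > 0" and m: "m > 4 / \<beta>\<^sup>2"
  shows "\<exists>r::real. - 2 / \<beta> \<le> r \<and> r \<le> 0 \<and> \<alpha> * r ^ 3 + r\<^sup>2 + \<beta> * m * r + m = 0"
proof -
  let ?p = "\<lambda>r. \<alpha> * r ^ 3 + r\<^sup>2 + \<beta> * m * r + m"
  have m0: "m > 0" by (rule le_less_trans[OF _ m]) simp
  have "\<alpha> * (- 2 / \<beta>) ^ 3 \<le> 0" using pos by (simp add: power3_eq_cube mult_le_0_iff)
  moreover have "(- 2 / \<beta>)\<^sup>2 = 4 / \<beta>\<^sup>2" by (simp add: power_divide)
  moreover have "\<beta> * m * (- 2 / \<beta>) = - 2 * m" using pos by simp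
  ultimately have "?p (- 2 / \<beta>) \<le> 0" using m by linarith
  moreover have "?p 0 \<ge> 0" using m0 by simp
  moreover have "- 2 / \<beta> \<le> 0" using pos by simp
  moreover have "continuous_on {- 2 / \<beta>..0} ?p" by (intro continuous_intros)
  ultimately show ?thesis using IVT'[of ?p "- 2 / \<beta>" 0 0] by blast
qed

lemma conjugate_roots:
  assumes sum: "y + z = complex_of_real s" and prod: "y * z = complex_of_real P"
    and neg: "s\<^sup>2 < 4 * P"
  shows "(cmod y)\<^sup>2 = P" "(cmod z)\<^sup>2 = P" "(cmod (y - z))\<^sup>2 = 4 * P - s\<^sup>2"
proof -
  have z: "z = of_real s - y" using sum by (simp add: algebra_simps)
  have re: "Re y * (s - Re y) + (Im y)\<^sup>2 = P" and im: "Im y * (s - 2 * Re y) = 0"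
    using prod by (simp_all add: z complex_eq_iff power2_eq_square algebra_simps)
  have "Im y \<noteq> 0"
  proof
    assume "Im y = 0"
    then have "4 * P - s\<^sup>2 = - (s - 2 * Re y)\<^sup>2" using re by algebra
    then show False using neg zero_le_power2[of "s - 2 * Re y"] by linarith
  qed
  then have s: "s = 2 * Re y" using im by simp
  show "(cmod y)\<^sup>2 = P" using re unfolding cmod_power2 by (simp add: s power2_eq_square)
  show "(cmod z)\<^sup>2 = P" using re unfolding cmod_power2 by (simp add: z s power2_eq_square)
  show "(cmod (y - z))\<^sup>2 = 4 * P - s\<^sup>2"
    using re unfolding cmod_power2 by (simp add: z s power2_eq_square algebra_simps)
qed

section \<open>Weights of the phase spaces\<close>

fun weight :: "space_index \<Rightarrow> real \<Rightarrow> real^3" where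
  "weight I1 m = vector [m, m, 1]"
| "weight I2 m = vector [m\<^sup>2, m\<^sup>2, m]"
| "weight I3 m = vector [m\<^sup>2, m, 1]"
| "weight I4 m = vector [m ^ 3, m\<^sup>2, m]"

lemma O_mat_weight:
  "O_mat \<mu> i n = (\<chi> k l. if k = l then of_real (weight i (\<mu> n) $ k) else 0)"
proof -
  have "O_mat \<mu> i n $ k $ l = (if k = l then of_real (weight i (\<mu> n) $ k) else 0)" for k l
    using exhaust_3[of k]
    by (cases i) (auto simp: diag3_def power2_eq_square power3_eq_cube scaleR_conv_of_real[where 'a = complex])
  then show ?thesis by (simp add: vec_eq_iff)
qed

lemma weight_pos: "m > 0 \<Longrightarrow> weight i m $ k > 0"
  using exhaust_3[of k] by (cases i) auto

text \<open>The square of the natural norm of a vector of \<open>E\<^sub>n\<close> with coordinates \<open>x\<close>, where \<open>m = \<mu> n\<close>.\<close>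

definition wnorm2 :: "space_index \<Rightarrow> real \<Rightarrow> complex^3 \<Rightarrow> real" where
  "wnorm2 i m x = (\<Sum>k\<in>UNIV. weight i m $ k * (cmod (x $ k))\<^sup>2)"

lemma herm_form_O_mat:
  "herm_form (O_mat \<mu> i n) x x = of_real (wnorm2 i (\<mu> n) x)"
proof -
  have "(O_mat \<mu> i n *v x) $ k = of_real (weight i (\<mu> n) $ k) * x $ k" for k
    by (simp add: O_mat_weight matrix_vector_mult_def if_distrib[of "\<lambda>t. t * _"] cong: if_cong)
  then have "herm_form (O_mat \<mu> i n) x x =
      (\<Sum>k\<in>UNIV. of_real (weight i (\<mu> n) $ k) * (x $ k * cnj (x $ k)))"
    by (simp add: herm_form_def mult_ac)
  then show ?thesis
    unfolding wnorm2_def of_real_sum of_real_mult complex_norm_square .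
qed

lemma wnorm2_nonneg: "m > 0 \<Longrightarrow> wnorm2 i m x \<ge> 0"
  unfolding wnorm2_def by (intro sum_nonneg mult_nonneg_nonneg) (auto simp: weight_pos less_imp_le)

lemma wnorm2_scaleR: "wnorm2 i m (r *\<^sub>R x) = r\<^sup>2 * wnorm2 i m x"
  by (simp add: wnorm2_def sum_distrib_left power_mult_distrib mult_ac)

lemma wnorm2_root_vec:
  "wnorm2 i m (root_vec l) =
    weight i m $ 1 + weight i m $ 2 * (cmod l)\<^sup>2 + weight i m $ 3 * (cmod l) ^ 4"
  by (simp add: wnorm2_def sum_3 root_vec_def norm_power)

lemma wnorm2_root_vec_pos: "m > 0 \<Longrightarrow> wnorm2 i m (root_vec l) > 0"
  unfolding wnorm2_root_vec
  by (intro add_pos_nonneg mult_nonneg_nonneg) (auto simp: weight_pos less_imp_le)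

definition wprod :: "space_index \<Rightarrow> real \<Rightarrow> real" where
  "wprod i m = weight i m $ 1 * weight i m $ 2 * weight i m $ 3"

text \<open>Divided by the product of the three norms, the right-hand side is the squared determinant of the
normalized eigenvectors in coordinates that are orthonormal for the natural scalar product. It
stays away from zero for large \<open>m\<close> because numerator and denominator grow with the same power of
\<open>m\<close>: the root \<open>r\<close> is bounded by \<open>R\<close>, so the sum \<open>s\<close> of the other two roots is bounded by \<open>S\<close> and
their product is \<open>P = k m - r s\<close>, about \<open>k m\<close>. Hence they form a complex conjugate pair with
\<open>\<bar>y\<bar>\<^sup>2 = \<bar>z\<bar>\<^sup>2 = P\<close>, and every factor is controlled by \<open>r\<close>, \<open>s\<close> and \<open>P\<close>.\<close>

lemma Gram_lower_bound_real_root: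
  fixes \<alpha> \<beta> :: real
  assumes pos: "\<alpha> > 0" "\<beta> > 0"
  defines "k \<equiv> \<beta> / \<alpha>" and "R \<equiv> 2 / \<beta>" and "S \<equiv> 1 / \<alpha> + 2 / \<beta>"
  defines "B \<equiv> 1 + R\<^sup>2 + R ^ 4" and "A \<equiv> 1 + 2 * k + 4 * k\<^sup>2"
  assumes cubic: "factors_cubic \<alpha> \<beta> m (of_real r) y z" and r: "- R \<le> r" "r \<le> 0"
    and m: "m \<ge> 1" "R * S \<le> k * m / 4" "S\<^sup>2 \<le> k * m"
  shows "k ^ 3 / (2 * B * A\<^sup>2) *
      (wnorm2 i m (root_vec (of_real r)) * wnorm2 i m (root_vec y) * wnorm2 i m (root_vec z))
    \<le> wprod i m * (cmod ((of_real r - y) * (of_real r - z) * (y - z)))\<^sup>2"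
proof -
  have kpos: "k > 0" using pos by (simp add: k_def)
  have Rpos: "R > 0" "S > 0" using pos by (simp_all add: R_def S_def add_pos_pos)
  define s P where "s = - (1 / \<alpha>) - r" and "P = k * m - r * s"
  have sum: "y + z = of_real s"
  proof -
    have "of_real r + y + z = (of_real \<alpha> * (of_real r + y + z)) / of_real \<alpha>"
      using pos by simp
    also have "\<dots> = - 1 / of_real \<alpha>" by (simp only: Vieta(1)[OF cubic])
    finally show ?thesis by (simp add: s_def algebra_simps)
  qed
  have "of_real r * (y + z) + y * z = of_real (k * m)"
  proof -
    have "of_real r * (y + z) + y * z
        = (of_real \<alpha> * (of_real r * y + of_real r * z + y * z)) / of_real \<alpha>"
      using pos by (subst nonzero_mult_div_cancel_left) (auto simp: distrib_left)
    also have "\<dots> = of_real (\<beta> * m) / of_real \<alpha>" by (simp only: Vieta(2)[OF cubic])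
    finally show ?thesis by (simp add: k_def)
  qed
  then have prod: "y * z = of_real P"
    unfolding sum by (simp add: P_def algebra_simps)
  have "1 / \<alpha> > 0" using pos by simp
  then have "\<bar>s\<bar> \<le> S" using r unfolding s_def S_def R_def by linarith
  moreover have "\<bar>r\<bar> \<le> R" using r by simp
  ultimately have rs: "\<bar>r * s\<bar> \<le> k * m / 4" and s2: "s\<^sup>2 \<le> k * m"
    using mult_mono[of "\<bar>r\<bar>" R "\<bar>s\<bar>" S] power_mono[of "\<bar>s\<bar>" S 2] m(2,3) Rpos
    by (auto simp: abs_mult)
  have km: "k * m > 0" using kpos m(1) by simp
  have P: "3 * (k * m) / 4 \<le> P" "P \<le> 2 * k * m" using rs km by (auto simp: P_def)
  have roots: "(cmod y)\<^sup>2 = P" "(cmod z)\<^sup>2 = P" "(cmod (y - z))\<^sup>2 = 4 * P - s\<^sup>2"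
    using conjugate_roots[OF sum prod] P(1) s2 km by auto
  have Y: "2 * (k * m) \<le> (cmod (y - z))\<^sup>2" using roots(3) P(1) s2 by simp
  have "(of_real r - y) * (of_real r - z) = of_real (r\<^sup>2) - of_real r * (y + z) + y * z"
    by (simp add: algebra_simps power2_eq_square)
  also have "\<dots> = of_real (r\<^sup>2 - r * s + P)" by (simp add: sum prod)
  finally have "cmod ((of_real r - y) * (of_real r - z)) = \<bar>r\<^sup>2 - r * s + P\<bar>"
    by (simp only: norm_of_real)
  moreover have "k * m / 2 \<le> r\<^sup>2 - r * s + P"
    using rs P(1) zero_le_power2[of r] by linarith
  ultimately have X: "k * m / 2 \<le> cmod ((of_real r - y) * (of_real r - z))" by linarith
  have "(k * m / 2)\<^sup>2 * (2 * (k * m)) \<le> (cmod ((of_real r - y) * (of_real r - z)))\<^sup>2 * (cmod (y - z))\<^sup>2"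
    using X Y km by (intro mult_mono power_mono) auto
  then have lower: "k ^ 3 / 2 * m ^ 3 \<le> (cmod ((of_real r - y) * (of_real r - z) * (y - z)))\<^sup>2"
    unfolding norm_mult[of "(of_real r - y) * (of_real r - z)"] power_mult_distrib[of "cmod _"]
    by (simp add: power_mult_distrib power_divide power2_eq_square power3_eq_cube mult_ac)
  have r2: "(cmod (of_real r))\<^sup>2 \<le> R\<^sup>2" and r4: "(cmod (of_real r)) ^ 4 \<le> R ^ 4"
    using power_mono[of "cmod (of_real r)" R] \<open>\<bar>r\<bar> \<le> R\<close> by (simp_all only: norm_of_real norm_ge_zero abs_ge_zero)
  have P4: "(cmod y) ^ 4 = P\<^sup>2" "(cmod z) ^ 4 = P\<^sup>2"
    using roots(1,2) by (metis power2_eq_square power4_eq_xxxx mult.assoc)+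
  have P0: "0 \<le> P" using P(1) km by linarith
  have P2: "P\<^sup>2 \<le> 4 * k\<^sup>2 * m\<^sup>2" using power_mono[OF P(2) P0, of 2] by (simp add: power_mult_distrib)
  have m0: "m > 0" using m(1) by simp
  (* The exponents depend on the phase space; only the balance p + 3 = q + 2 * t matters, where
     3 is the degree of the Vandermonde factor. *)
  have bounds: "\<exists>p q t. wprod i m = m ^ p \<and> p + 3 = q + 2 * t
      \<and> wnorm2 i m (root_vec (of_real r)) \<le> B * m ^ q
      \<and> wnorm2 i m (root_vec y) \<le> A * m ^ t \<and> wnorm2 i m (root_vec z) \<le> A * m ^ t"
  proof -
    have mm: "m \<le> m\<^sup>2" using self_le_power[of m 2] m(1) by simp
    have R4: "R ^ 4 \<le> R ^ 4 * m" "R ^ 4 * m \<le> R ^ 4 * m\<^sup>2" "R\<^sup>2 * m \<le> R\<^sup>2 * m\<^sup>2"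
      using m(1) mm by (simp_all add: mult_left_mono mult_le_cancel_left1)
    have mP: "m * P \<le> 2 * k * m\<^sup>2"
      using mult_left_mono[OF P(2), of m] m0 by (simp add: power2_eq_square mult_ac)
    have mr: "m * (cmod (of_real r))\<^sup>2 \<le> R\<^sup>2 * m"
      using mult_left_mono[OF r2, of m] m0 by (simp add: mult_ac)
    have b1: "m + m * (cmod (of_real r))\<^sup>2 + (cmod (of_real r)) ^ 4 \<le> B * m"
      using mr r4 R4(1) by (simp add: B_def distrib_right)
    have b2: "m + m * P + P\<^sup>2 \<le> A * m\<^sup>2"
      using mm mP P2 by (simp add: A_def distrib_right)
    have b3: "m\<^sup>2 + m * (cmod (of_real r))\<^sup>2 + (cmod (of_real r)) ^ 4 \<le> B * m\<^sup>2"
      using mr r4 R4 by (simp add: B_def distrib_right)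
    have b4: "m\<^sup>2 + m * P + P\<^sup>2 \<le> A * m\<^sup>2"
      using mP P2 by (simp add: A_def distrib_right)
    have times_m: "m * u \<le> C * m ^ Suc q" if "u \<le> C * m ^ q" for u C and q :: nat
      using mult_left_mono[OF that, of m] m0 by (simp add: mult_ac)
    have wyz: "wnorm2 i m (root_vec y) = weight i m $ 1 + weight i m $ 2 * P + weight i m $ 3 * P\<^sup>2"
      "wnorm2 i m (root_vec z) = weight i m $ 1 + weight i m $ 2 * P + weight i m $ 3 * P\<^sup>2"
      by (simp_all add: wnorm2_root_vec roots P4)
    show ?thesis
    proof (cases i)
      case I1
      then have "wprod i m = m ^ 2" by (simp add: wprod_def power2_eq_square)
      moreover have "wnorm2 i m (root_vec (of_real r)) \<le> B * m ^ 1"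
        using b1 by (simp add: I1 wnorm2_root_vec)
      moreover have "wnorm2 i m (root_vec y) \<le> A * m ^ 2" "wnorm2 i m (root_vec z) \<le> A * m ^ 2"
        using b2 by (simp_all add: wyz[unfolded I1] I1)
      ultimately show ?thesis by (intro exI[of _ 2] exI[of _ 1] conjI) simp_all
    next
      case I2
      then have "wprod i m = m ^ 5" by (simp add: wprod_def eval_nat_numeral)
      moreover have "wnorm2 i m (root_vec (of_real r)) \<le> B * m ^ 2"
        using times_m[of _ B 1, unfolded power_one_right, OF b1]
        by (simp add: I2 wnorm2_root_vec power2_eq_square distrib_left mult.assoc)
      moreover have "wnorm2 i m (root_vec y) \<le> A * m ^ 3" "wnorm2 i m (root_vec z) \<le> A * m ^ 3"
        using times_m[of _ A 2, OF b2]
        by (simp_all add: wyz[unfolded I2] I2 power2_eq_square power3_eq_cube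
            distrib_left mult.assoc numeral_3_eq_3)
      ultimately show ?thesis by (intro exI[of _ 5] exI[of _ 2] exI[of _ 3] conjI) simp_all
    next
      case I3
      then have "wprod i m = m ^ 3" by (simp add: wprod_def power2_eq_square power3_eq_cube)
      moreover have "wnorm2 i m (root_vec (of_real r)) \<le> B * m ^ 2"
        using b3 by (simp add: I3 wnorm2_root_vec)
      moreover have "wnorm2 i m (root_vec y) \<le> A * m ^ 2" "wnorm2 i m (root_vec z) \<le> A * m ^ 2"
        using b4 by (simp_all add: wyz[unfolded I3] I3)
      ultimately show ?thesis by (intro exI[of _ 3] exI[of _ 2] conjI) simp_all
    next
      case I4
      then have "wprod i m = m ^ 6" by (simp add: wprod_def eval_nat_numeral)
      moreover have "wnorm2 i m (root_vec (of_real r)) \<le> B * m ^ 3"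
        using times_m[of _ B 2, OF b3]
        by (simp add: I4 wnorm2_root_vec power2_eq_square power3_eq_cube distrib_left mult.assoc
            numeral_3_eq_3)
      moreover have "wnorm2 i m (root_vec y) \<le> A * m ^ 3" "wnorm2 i m (root_vec z) \<le> A * m ^ 3"
        using times_m[of _ A 2, OF b4]
        by (simp_all add: wyz[unfolded I4] I4 power2_eq_square power3_eq_cube
            distrib_left mult.assoc numeral_3_eq_3)
      ultimately show ?thesis by (intro exI[of _ 6] exI[of _ 3] exI[of _ 3] conjI) simp_all
    qed
  qed
  then obtain p q t where wp: "wprod i m = m ^ p" "p + 3 = q + 2 * t"
    and b: "wnorm2 i m (root_vec (of_real r)) \<le> B * m ^ q"
      "wnorm2 i m (root_vec y) \<le> A * m ^ t" "wnorm2 i m (root_vec z) \<le> A * m ^ t"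
    by blast
  have AB: "A > 0" "B > 0" using kpos by (auto simp: A_def B_def add_pos_nonneg)
  have "wnorm2 i m (root_vec (of_real r)) * wnorm2 i m (root_vec y) * wnorm2 i m (root_vec z)
      \<le> (B * m ^ q) * (A * m ^ t) * (A * m ^ t)"
    using AB m0 by (intro mult_mono b) (auto intro!: mult_nonneg_nonneg wnorm2_nonneg)
  then have "k ^ 3 / (2 * B * A\<^sup>2) * (wnorm2 i m (root_vec (of_real r)) * wnorm2 i m (root_vec y)
      * wnorm2 i m (root_vec z)) \<le> k ^ 3 / (2 * B * A\<^sup>2) * ((B * m ^ q) * (A * m ^ t) * (A * m ^ t))"
    using AB kpos by (intro mult_left_mono) auto
  also have "\<dots> = k ^ 3 / 2 * m ^ (q + 2 * t)"
    using AB by (simp add: power_add power_mult power2_eq_square field_simps)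
  also have "\<dots> = wprod i m * (k ^ 3 / 2 * m ^ 3)"
    by (simp add: wp power_add flip: wp(2))
  also have "\<dots> \<le> wprod i m * (cmod ((of_real r - y) * (of_real r - z) * (y - z)))\<^sup>2"
    using lower m0 by (intro mult_left_mono) (auto simp: wp)
  finally show ?thesis .
qed

text \<open>The bound is symmetric in the roots, so it is enough that one of the three is the bounded real
root.\<close>

lemma Gram_lower_bound:
  fixes \<alpha> \<beta> :: real
  assumes pos: "\<alpha> > 0" "\<beta> > 0"
  shows "\<exists>\<delta>>0. \<exists>M. \<forall>m\<ge>M. \<forall>i x y z. factors_cubic \<alpha> \<beta> m x y z \<longrightarrow>
    \<delta> * (wnorm2 i m (root_vec x) * wnorm2 i m (root_vec y) * wnorm2 i m (root_vec z))
      \<le> wprod i m * (cmod ((x - y) * (x - z) * (y - z)))\<^sup>2"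
proof -
  define k R S where "k = \<beta> / \<alpha>" and "R = 2 / \<beta>" and "S = 1 / \<alpha> + 2 / \<beta>"
  define \<delta> where "\<delta> = k ^ 3 / (2 * (1 + R\<^sup>2 + R ^ 4) * (1 + 2 * k + 4 * k\<^sup>2)\<^sup>2)"
  define M where "M = 1 + \<bar>4 * (R * S) / k\<bar> + \<bar>S\<^sup>2 / k\<bar> + 4 / \<beta>\<^sup>2"
  have kpos: "k > 0" "R > 0" using pos by (simp_all add: k_def R_def)
  then have "\<delta> > 0" by (auto simp: \<delta>_def intro!: divide_pos_pos mult_pos_pos add_pos_nonneg zero_less_power)
  moreover have "\<delta> * (wnorm2 i m (root_vec x) * wnorm2 i m (root_vec y) * wnorm2 i m (root_vec z))
      \<le> wprod i m * (cmod ((x - y) * (x - z) * (y - z)))\<^sup>2"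
    if m: "m \<ge> M" and cubic: "factors_cubic \<alpha> \<beta> m x y z" for m i x y z
  proof -
    have "0 \<le> 4 / \<beta>\<^sup>2" by simp
    then have m': "m \<ge> 1" "4 * (R * S) / k \<le> m" "S\<^sup>2 / k \<le> m" "m > 4 / \<beta>\<^sup>2"
      using m unfolding M_def by linarith+
    then have m'': "R * S \<le> k * m / 4" "S\<^sup>2 \<le> k * m"
      using kpos by (simp_all add: field_simps)
    obtain r :: real where r: "- R \<le> r" "r \<le> 0"
      and root: "\<alpha> * r ^ 3 + r\<^sup>2 + \<beta> * m * r + m = 0"
      using bounded_real_root[OF pos m'(4)] by (auto simp: R_def)
    have bound: "\<delta> * (wnorm2 i m (root_vec u) * wnorm2 i m (root_vec v) * wnorm2 i m (root_vec w))
        \<le> wprod i m * (cmod ((u - v) * (u - w) * (v - w)))\<^sup>2"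
      if "u = of_real r" "factors_cubic \<alpha> \<beta> m u v w" for u v w
      using Gram_lower_bound_real_root[OF pos, of m r v w i] that r m'(1) m''
      by (simp add: \<delta>_def k_def R_def S_def)
    have "of_real \<alpha> * of_real r ^ 3 + (of_real r)\<^sup>2 + of_real (\<beta> * m) * of_real r + of_real m
        = complex_of_real (\<alpha> * r ^ 3 + r\<^sup>2 + \<beta> * m * r + m)" by simp
    also have "\<dots> = 0" by (simp only: root of_real_0)
    finally have "of_real \<alpha> * ((of_real r - x) * (of_real r - y) * (of_real r - z)) = 0"
      using cubic by (simp only: factors_cubic_def)
    then consider "x = of_real r" | "y = of_real r" | "z = of_real r"
      using pos by auto
    then show ?thesis
    proof cases
      case 1
      then show ?thesis using bound cubic by blast
    next
      case 2
      have eq: "(x - y) * (x - z) * (y - z) = - ((y - x) * (y - z) * (x - z))" by algebra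
      then show ?thesis
        using bound[OF 2 factors_cubic_swap(1)[OF cubic]] unfolding eq by (simp add: mult_ac)
    next
      case 3
      have eq: "(x - y) * (x - z) * (y - z) = (z - x) * (z - y) * (x - y)" by algebra
      then show ?thesis
        using bound[OF 3 factors_cubic_swap(1)[OF factors_cubic_swap(2)[OF cubic]]]
        unfolding eq by (simp add: mult_ac)
    qed
  qed
  ultimately show ?thesis by blast
qed

section \<open>Uniformly bounded matrices\<close>

lemma norm_le_sum_cart: "norm (x :: complex^'n::finite) \<le> (\<Sum>k\<in>UNIV. cmod (x $ k))"
  unfolding norm_vec_def by (rule L2_set_le_sum) simp

lemma norm_matrix_vector_le:
  fixes S :: "complex^3^3"
  assumes "\<And>k j. cmod (S $ k $ j) \<le> 1"
  shows "norm (S *v a) \<le> 9 * norm a"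
proof -
  have "cmod ((S *v a) $ k) \<le> 3 * norm a" for k
  proof -
    have "cmod ((S *v a) $ k) \<le> (\<Sum>j\<in>(UNIV :: 3 set). 1 * norm a)"
      unfolding matrix_vector_mult_def vec_lambda_beta
      by (rule sum_norm_le)
        (auto simp only: norm_mult norm_ge_zero intro!: mult_mono assms Finite_Cartesian_Product.norm_nth_le)
    then show ?thesis by (simp add: sum_3)
  qed
  then have "(\<Sum>k\<in>UNIV. cmod ((S *v a) $ k)) \<le> (\<Sum>k\<in>(UNIV :: 3 set). 3 * norm a)"
    by (rule sum_mono)
  then show ?thesis using norm_le_sum_cart[of "S *v a"] by (simp add: sum_3)
qed

lemma cmod_det_3_le:
  fixes A :: "complex^3^3"
  assumes A: "\<And>k j. cmod (A $ k $ j) \<le> (if j = i then b else 1)"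
  shows "cmod (det A) \<le> 6 * b"
proof -
  have b: "0 \<le> b" using A[of 1 i] by (simp add: order.trans[OF norm_ge_zero])
  have summand: "cmod (A $ p $ 1 * A $ q $ 2 * A $ r $ 3) \<le> b" for p q r
  proof -
    have "cmod (A $ p $ 1 * A $ q $ 2 * A $ r $ 3)
        \<le> (if 1 = i then b else 1) * (if 2 = i then b else 1) * (if 3 = i then b else 1)"
      unfolding norm_mult using b by (intro mult_mono A) auto
    also have "\<dots> = b" using exhaust_3[of i] by auto
    finally show ?thesis .
  qed
  have "det A = A $ 1 $ 1 * A $ 2 $ 2 * A $ 3 $ 3 + A $ 3 $ 1 * A $ 1 $ 2 * A $ 2 $ 3
      + A $ 2 $ 1 * A $ 3 $ 2 * A $ 1 $ 3 - A $ 1 $ 1 * A $ 3 $ 2 * A $ 2 $ 3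
      - A $ 2 $ 1 * A $ 1 $ 2 * A $ 3 $ 3 - A $ 3 $ 1 * A $ 2 $ 2 * A $ 1 $ 3"
    unfolding det_3 by algebra
  also have "cmod \<dots> \<le> b + b + b + b + b + b"
    by (intro order.trans[OF norm_triangle_ineq4 add_mono] order.trans[OF norm_triangle_ineq add_mono] summand)
  finally show ?thesis by simp
qed

text \<open>Cramer's rule: each coordinate of \<open>a\<close> is a quotient of determinants, and the numerator has the
entries of \<open>S *v a\<close> in one column and entries of modulus at most \<open>1\<close> elsewhere. The constant is
crude; what matters is that it depends on \<open>d\<close> alone.\<close>

lemma norm_le_matrix_vector:
  fixes S :: "complex^3^3"
  assumes S: "\<And>k j. cmod (S $ k $ j) \<le> 1" and det: "d \<le> cmod (det S)" "d > 0"
  shows "norm a \<le> 18 / d * norm (S *v a)"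
proof -
  have "cmod (a $ k) \<le> 6 / d * norm (S *v a)" for k
  proof -
    have "cmod (a $ k) * d \<le> cmod (a $ k * det S)"
      using det by (simp add: norm_mult mult_left_mono)
    also have "\<dots> = cmod (det (\<chi> i j. if j = k then (S *v a) $ i else S $ i $ j))"
      by (simp only: cramer_lemma)
    also have "\<dots> \<le> 6 * norm (S *v a)"
      by (rule cmod_det_3_le[where i = k]) (auto simp: S Finite_Cartesian_Product.norm_nth_le)
    finally show ?thesis using det by (simp add: field_simps)
  qed
  then have "(\<Sum>k\<in>UNIV. cmod (a $ k)) \<le> (\<Sum>k\<in>(UNIV :: 3 set). 6 / d * norm (S *v a))"
    by (rule sum_mono)
  then show ?thesis using norm_le_sum_cart[of a] by (simp add: sum_3)
qed

lemma eventually_bounded_below: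
  fixes f :: "nat \<Rightarrow> real"
  assumes "\<And>n. f n > 0" and "d > 0" and "\<And>n. n \<ge> N \<Longrightarrow> d \<le> f n"
  shows "\<exists>d>0. \<forall>n. d \<le> f n"
proof -
  define c where "c = Min (insert d (f ` {..<N}))"
  have "c > 0" using assms(1,2) by (auto simp: c_def)
  moreover have "c \<le> f n" for n
  proof (cases "n < N")
    case True
    then show ?thesis unfolding c_def by (intro Min_le) auto
  next
    case False
    have "c \<le> d" unfolding c_def by (intro Min_le) auto
    then show ?thesis using assms(3)[of n] False by simp
  qed
  ultimately show ?thesis by blast
qed

section \<open>The matrices of normalized eigenvectors\<close>

locale characteristic_cubic =
  fixes \<alpha> \<beta> :: real and \<mu> :: "nat \<Rightarrow> real" and \<rho> :: "nat \<Rightarrow> 3 \<Rightarrow> complex"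
  assumes pos: "\<alpha> > 0" "\<beta> > 0" and \<mu>_pos: "\<And>n. \<mu> n > 0"
    and \<mu>_top: "filterlim \<mu> at_top sequentially"
    and roots: "characteristic_roots \<alpha> \<beta> \<mu> \<rho>"
begin

lemmas factors = characteristic_roots_factors[OF roots]

lemma psi_norm_eq: "psi_norm \<mu> \<rho> i n j = sqrt (wnorm2 i (\<mu> n) (root_vec (\<rho> n j)))"
  by (simp add: psi_norm_def ip_norm_def herm_form_O_mat)

lemma psi_norm_pos: "psi_norm \<mu> \<rho> i n j > 0"
  by (simp add: psi_norm_eq wnorm2_root_vec_pos \<mu>_pos)

lemma psi_norm_square: "(psi_norm \<mu> \<rho> i n j)\<^sup>2 = wnorm2 i (\<mu> n) (root_vec (\<rho> n j))"
  by (simp add: psi_norm_eq wnorm2_nonneg \<mu>_pos)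

lemma wnorm2_psi_vec: "wnorm2 i (\<mu> n) (psi_vec \<mu> \<rho> i n j) = 1"
  using psi_norm_pos[of i n j]
  by (simp add: psi_vec_def wnorm2_scaleR power_divide flip: psi_norm_square)

text \<open>The eigenvector matrix in coordinates that are orthonormal for the natural scalar product. Its
columns are unit vectors, so its entries have modulus at most \<open>1\<close>.\<close>

definition scaled :: "space_index \<Rightarrow> nat \<Rightarrow> complex^3^3" where
  "scaled i n = (\<chi> k j. of_real (sqrt (weight i (\<mu> n) $ k)) * C_mat \<mu> \<rho> i n $ k $ j)"

lemma norm_scaled: "(norm (scaled i n *v a))\<^sup>2 = wnorm2 i (\<mu> n) (C_mat \<mu> \<rho> i n *v a)"
proof -
  have "(scaled i n *v a) $ k = of_real (sqrt (weight i (\<mu> n) $ k)) * (C_mat \<mu> \<rho> i n *v a) $ k" for k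
    by (simp add: scaled_def matrix_vector_mult_def sum_distrib_left mult.assoc)
  then show ?thesis
    using weight_pos[OF \<mu>_pos]
    by (simp add: norm_square_cart wnorm2_def norm_mult power_mult_distrib less_imp_le)
qed

lemma scaled_entry_le: "cmod (scaled i n $ k $ j) \<le> 1"
proof -
  have w: "weight i (\<mu> n) $ l \<ge> 0" for l using weight_pos[OF \<mu>_pos] by (simp add: less_imp_le)
  have "(cmod (scaled i n $ k $ j))\<^sup>2 = weight i (\<mu> n) $ k * (cmod (psi_vec \<mu> \<rho> i n j $ k))\<^sup>2"
    using w by (simp add: scaled_def C_mat_def norm_mult power_mult_distrib)
  also have "\<dots> \<le> wnorm2 i (\<mu> n) (psi_vec \<mu> \<rho> i n j)"
    unfolding wnorm2_def using w by (intro member_le_sum) auto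
  finally show ?thesis by (simp add: wnorm2_psi_vec power_le_one_iff abs_square_le_1)
qed

definition Vandermonde :: "nat \<Rightarrow> complex" where
  "Vandermonde n = (\<rho> n 1 - \<rho> n 2) * (\<rho> n 1 - \<rho> n 3) * (\<rho> n 2 - \<rho> n 3)"

lemma det_scaled:
  "(cmod (det (scaled i n)))\<^sup>2 * (wnorm2 i (\<mu> n) (root_vec (\<rho> n 1)) *
     wnorm2 i (\<mu> n) (root_vec (\<rho> n 2)) * wnorm2 i (\<mu> n) (root_vec (\<rho> n 3)))
   = wprod i (\<mu> n) * (cmod (Vandermonde n))\<^sup>2"
proof -
  define s where "s k = complex_of_real (sqrt (weight i (\<mu> n) $ k))" for k
  define c where "c j = complex_of_real (psi_norm \<mu> \<rho> i n j)" for j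
  have c: "c j \<noteq> 0" for j using psi_norm_pos[of i n j] by (simp add: c_def)
  have entry: "scaled i n $ k $ j * c j = s k * root_vec (\<rho> n j) $ k" for k j
    using c[of j] by (simp add: scaled_def C_mat_def psi_vec_def s_def c_def scaleR_conv_of_real[where 'a = complex])
  have "det (scaled i n) * (c 1 * c 2 * c 3) =
      (scaled i n $ 1 $ 1 * c 1) * (scaled i n $ 2 $ 2 * c 2) * (scaled i n $ 3 $ 3 * c 3) +
      (scaled i n $ 1 $ 2 * c 2) * (scaled i n $ 2 $ 3 * c 3) * (scaled i n $ 3 $ 1 * c 1) +
      (scaled i n $ 1 $ 3 * c 3) * (scaled i n $ 2 $ 1 * c 1) * (scaled i n $ 3 $ 2 * c 2) -
      (scaled i n $ 1 $ 1 * c 1) * (scaled i n $ 2 $ 3 * c 3) * (scaled i n $ 3 $ 2 * c 2) -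
      (scaled i n $ 1 $ 2 * c 2) * (scaled i n $ 2 $ 1 * c 1) * (scaled i n $ 3 $ 3 * c 3) -
      (scaled i n $ 1 $ 3 * c 3) * (scaled i n $ 2 $ 2 * c 2) * (scaled i n $ 3 $ 1 * c 1)"
    unfolding det_3 by algebra
  also have "\<dots> = - (s 1 * s 2 * s 3 * Vandermonde n)"
    unfolding entry Vandermonde_def root_vec_def vector_3 by algebra
  finally have "(cmod (det (scaled i n) * (c 1 * c 2 * c 3)))\<^sup>2 =
      (cmod (s 1 * s 2 * s 3 * Vandermonde n))\<^sup>2" by simp
  moreover have "(cmod (s k))\<^sup>2 = weight i (\<mu> n) $ k" for k
    using weight_pos[OF \<mu>_pos, of i n k] by (simp add: s_def)
  moreover have "(cmod (c j))\<^sup>2 = wnorm2 i (\<mu> n) (root_vec (\<rho> n j))" for j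
    by (simp add: c_def psi_norm_square)
  ultimately show ?thesis
    by (simp only: norm_mult power_mult_distrib wprod_def)
qed

lemma Vandermonde_zero_iff:
  "Vandermonde n = 0 \<longleftrightarrow> of_real (\<mu> n) = m1 \<alpha> \<beta> \<or> of_real (\<mu> n) = m2 \<alpha> \<beta>"
  unfolding multiple_root_iff[OF pos \<mu>_pos factors] by (simp add: Vandermonde_def)

lemma wnorm2_C_mat_le: "wnorm2 i (\<mu> n) (C_mat \<mu> \<rho> i n *v a) \<le> 81 * (norm a)\<^sup>2"
  using power_mono[OF norm_matrix_vector_le[OF scaled_entry_le, of i n a] norm_ge_zero, of 2]
  by (simp add: norm_scaled power_mult_distrib)

end

locale distinct_characteristic_cubic = characteristic_cubic +
  assumes distinct: "\<And>n. of_real (\<mu> n) \<noteq> m1 \<alpha> \<beta> \<and> of_real (\<mu> n) \<noteq> m2 \<alpha> \<beta>"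
begin

lemma Vandermonde_nonzero: "Vandermonde n \<noteq> 0"
  using distinct Vandermonde_zero_iff by blast

lemma wprod_pos: "wprod i (\<mu> n) > 0"
  using weight_pos[OF \<mu>_pos] by (simp add: wprod_def)

lemma det_scaled_bounded_below: "\<exists>d>0. \<forall>n. d \<le> (cmod (det (scaled i n)))\<^sup>2"
proof -
  define c where "c n = wnorm2 i (\<mu> n) (root_vec (\<rho> n 1)) *
     wnorm2 i (\<mu> n) (root_vec (\<rho> n 2)) * wnorm2 i (\<mu> n) (root_vec (\<rho> n 3))" for n
  have c: "c n > 0" for n by (simp add: c_def wnorm2_root_vec_pos \<mu>_pos)
  have det: "(cmod (det (scaled i n)))\<^sup>2 = wprod i (\<mu> n) * (cmod (Vandermonde n))\<^sup>2 / c n" for n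
    using det_scaled[of i n] c[of n] unfolding c_def[symmetric] by (simp add: eq_divide_eq)
  obtain d M where d: "d > 0" and M: "\<And>m i x y z. \<lbrakk>m \<ge> M; factors_cubic \<alpha> \<beta> m x y z\<rbrakk> \<Longrightarrow>
    d * (wnorm2 i m (root_vec x) * wnorm2 i m (root_vec y) * wnorm2 i m (root_vec z))
      \<le> wprod i m * (cmod ((x - y) * (x - z) * (y - z)))\<^sup>2"
    using Gram_lower_bound[OF pos] by blast
  obtain N where N: "\<And>n. n \<ge> N \<Longrightarrow> \<mu> n \<ge> M"
    using \<mu>_top unfolding filterlim_at_top eventually_sequentially by meson
  show ?thesis
  proof (rule eventually_bounded_below[OF _ d])
    show "0 < (cmod (det (scaled i n)))\<^sup>2" for n
      using c[of n] wprod_pos[of i n] Vandermonde_nonzero[of n] by (simp add: det)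
    show "d \<le> (cmod (det (scaled i n)))\<^sup>2" if "n \<ge> N" for n
      using M[OF N[OF that] factors, of i] c[of n]
      by (simp add: det c_def Vandermonde_def pos_le_divide_eq)
  qed
qed

text \<open>The eigenvector bases of the spaces \<open>E\<^sub>n\<close> are uniformly well conditioned. Distinctness of the roots
alone gives this for each single \<open>n\<close>; uniformity in \<open>n\<close> rests on the lower bound for the
determinants as \<open>\<mu> n\<close> tends to infinity.\<close>

lemma Riesz_bound:
  "\<exists>K>0. \<forall>n a. (norm a)\<^sup>2 \<le> K * wnorm2 i (\<mu> n) (C_mat \<mu> \<rho> i n *v a)"
proof -
  obtain d where d: "d > 0" "\<And>n. d \<le> (cmod (det (scaled i n)))\<^sup>2"
    using det_scaled_bounded_below by blast
  have "(norm a)\<^sup>2 \<le> (18 / sqrt d)\<^sup>2 * wnorm2 i (\<mu> n) (C_mat \<mu> \<rho> i n *v a)" for n a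
  proof -
    have "sqrt d \<le> cmod (det (scaled i n))" using d(2)[of n] by (simp add: real_le_lsqrt)
    from norm_le_matrix_vector[OF scaled_entry_le this, of a] d(1)
    have "(norm a)\<^sup>2 \<le> (18 / sqrt d * norm (scaled i n *v a))\<^sup>2"
      by (intro power_mono) auto
    then show ?thesis by (simp only: power_mult_distrib norm_scaled)
  qed
  moreover have "(18 / sqrt d)\<^sup>2 > 0" using d(1) by simp
  ultimately show ?thesis by blast
qed

lemma C_mat_inverse:
  "C_mat \<mu> \<rho> i n *v (matrix_inv (C_mat \<mu> \<rho> i n) *v x) = x"
  "matrix_inv (C_mat \<mu> \<rho> i n) *v (C_mat \<mu> \<rho> i n *v x) = x"
proof -
  obtain K where K: "\<And>n a. (norm a)\<^sup>2 \<le> K * wnorm2 i (\<mu> n) (C_mat \<mu> \<rho> i n *v a)"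
    using Riesz_bound[of i] by blast
  have "a = 0" if "C_mat \<mu> \<rho> i n *v a = 0" for a
    using K[of a n] that by (simp add: wnorm2_def)
  then have "invertible (C_mat \<mu> \<rho> i n)"
    unfolding invertible_left_inverse matrix_left_invertible_ker by blast
  then have "C_mat \<mu> \<rho> i n ** matrix_inv (C_mat \<mu> \<rho> i n) = mat 1"
    "matrix_inv (C_mat \<mu> \<rho> i n) ** C_mat \<mu> \<rho> i n = mat 1"
    unfolding invertible_def matrix_inv_def by (metis (mono_tags, lifting) someI_ex)+
  then show "C_mat \<mu> \<rho> i n *v (matrix_inv (C_mat \<mu> \<rho> i n) *v x) = x"
    "matrix_inv (C_mat \<mu> \<rho> i n) *v (C_mat \<mu> \<rho> i n *v x) = x"
    by (simp_all add: matrix_vector_mul_assoc)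
qed

end

section \<open>Phase spaces in coordinates\<close>

lemma summable_add3_iff:
  fixes f g h :: "nat \<Rightarrow> real"
  assumes "\<And>n. f n \<ge> 0" "\<And>n. g n \<ge> 0" "\<And>n. h n \<ge> 0"
  shows "summable (\<lambda>n. f n + g n + h n) \<longleftrightarrow> summable f \<and> summable g \<and> summable h"
proof
  assume s: "summable (\<lambda>n. f n + g n + h n)"
  have "norm (f n) \<le> f n + g n + h n" "norm (g n) \<le> f n + g n + h n"
    "norm (h n) \<le> f n + g n + h n" for n
    using assms[of n] by simp_all
  then show "summable f \<and> summable g \<and> summable h"
    by (intro conjI summable_comparison_test'[OF s])
qed (intro summable_add; simp)

lemma coords_nth [simp]:
  "coords \<phi> n (u, v, w) $ 1 = cinner (\<phi> n) u"
  "coords \<phi> n (u, v, w) $ 2 = cinner (\<phi> n) v"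
  "coords \<phi> n (u, v, w) $ 3 = cinner (\<phi> n) w"
  by (simp_all add: coords_def)

lemma coords_add: "coords \<phi> n (U + W) = coords \<phi> n U + coords \<phi> n W"
  by (cases U; cases W) (simp add: vec_eq_iff forall_3 cinner_simps)

lemma coords_scaleC: "coords \<phi> n (c *\<^sub>C U) = c *s coords \<phi> n U"
  by (cases U) (simp add: vec_eq_iff forall_3 cinner_simps scaleC_prod_def)

context diagonal_self_adjoint
begin

lemma pow_dom_iff: "x \<in> pow_dom \<mu> \<phi> s \<longleftrightarrow> summable (\<lambda>n. (\<mu> n powr s)\<^sup>2 * (cmod (coord x n))\<^sup>2)"
  by (simp add: pow_dom_def power_mult_distrib)

lemma D_iff: "x \<in> D \<longleftrightarrow> summable (\<lambda>n. (\<mu> n)\<^sup>2 * (cmod (coord x n))\<^sup>2)"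
  by (subst domain_eq) (simp add: norm_mult power_mult_distrib)

lemma ip_via_L:
  assumes "x \<in> D"
  shows "(\<lambda>n. (\<mu> n)\<^sup>2 * (cmod (coord x n))\<^sup>2) sums Re (ip_via L x x)"
  using Parseval_norm[of "L x"] assms
  by (simp add: ip_via_def cinner_self coord_L norm_mult power_mult_distrib)

lemma ip_via_pow_op:
  assumes "x \<in> pow_dom \<mu> \<phi> s"
  shows "(\<lambda>n. (\<mu> n powr s)\<^sup>2 * (cmod (coord x n))\<^sup>2) sums Re (ip_via (pow_op \<mu> \<phi> s) x x)"
proof -
  have "summable (\<lambda>n. (cmod (complex_of_real (\<mu> n powr s) * coord x n))\<^sup>2)"
    using assms by (simp add: pow_dom_iff norm_mult power_mult_distrib)
  then have "coord (pow_op \<mu> \<phi> s x) n = complex_of_real (\<mu> n powr s) * coord x n" for n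
    unfolding pow_op_def by (rule Riesz_Fischer)
  then show ?thesis
    using Parseval_norm[of "pow_op \<mu> \<phi> s x"]
    by (simp add: ip_via_def cinner_self norm_mult power_mult_distrib)
qed

lemma coords_eqI: "(\<And>n. coords \<phi> n U = coords \<phi> n W) \<Longrightarrow> U = W"
  by (cases U; cases W) (auto simp: vec_eq_iff forall_3 intro: eq_if_coord_eq)

lemma coords_embed: "coords \<phi> m (embed \<phi> n x) = (if m = n then x else 0)"
  by (simp add: embed_def vec_eq_iff forall_3 cinner_simps cinner_basis)

end

text \<open>Multiplication by the companion matrix of the characteristic cubic: the action of the operator on
\<open>E\<^sub>n\<close> for \<open>m = \<mu> n\<close>.\<close>

definition evolve :: "real \<Rightarrow> real \<Rightarrow> real \<Rightarrow> complex^3 \<Rightarrow> complex^3" where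
  "evolve \<alpha> \<beta> m x = vector [x $ 2, x $ 3,
     - (of_real (m / \<alpha>) * (x $ 1 + of_real \<beta> * x $ 2)) - of_real (1 / \<alpha>) * x $ 3]"

locale mgt = diagonal_self_adjoint \<phi> D L \<mu> + characteristic_cubic \<alpha> \<beta> \<mu> \<rho>
  for \<phi> :: "nat \<Rightarrow> 'a::complex_hilbert" and D L \<mu> \<alpha> \<beta> \<rho> +
  assumes mono: "mono \<mu>"
begin

abbreviation phase :: "space_index \<Rightarrow> ('a \<times> 'a \<times> 'a) set"
  where "phase i \<equiv> phase_space D \<mu> \<phi> i"

abbreviation domain :: "space_index \<Rightarrow> ('a \<times> 'a \<times> 'a) set"
  where "domain i \<equiv> mgt_dom \<alpha> \<beta> D L \<mu> \<phi> i"

abbreviation operator :: "'a \<times> 'a \<times> 'a \<Rightarrow> 'a \<times> 'a \<times> 'a"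
  where "operator \<equiv> mgt_op \<alpha> \<beta> L"

lemma powr_squares: "(\<mu> n powr (1/2))\<^sup>2 = \<mu> n" "(\<mu> n powr (3/2))\<^sup>2 = \<mu> n ^ 3"
  using \<mu>_pos[of n] by (simp_all add: powr_power)

lemma phase_iff: "U \<in> phase i \<longleftrightarrow> summable (\<lambda>n. wnorm2 i (\<mu> n) (coords \<phi> n U))"
proof -
  obtain u v w where U: "U = (u, v, w)" by (cases U)
  have "summable (\<lambda>n. wnorm2 i (\<mu> n) (coords \<phi> n U)) \<longleftrightarrow>
      summable (\<lambda>n. weight i (\<mu> n) $ 1 * (cmod (coord u n))\<^sup>2) \<and>
      summable (\<lambda>n. weight i (\<mu> n) $ 2 * (cmod (coord v n))\<^sup>2) \<and>
      summable (\<lambda>n. weight i (\<mu> n) $ 3 * (cmod (coord w n))\<^sup>2)"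
    unfolding wnorm2_def sum_3 U coords_nth
    by (rule summable_add3_iff) (auto simp: weight_pos[OF \<mu>_pos] less_imp_le)
  also have "\<dots> \<longleftrightarrow> U \<in> phase i"
    by (cases i) (auto simp: U pow_dom_iff D_iff powr_squares[simplified] summable_coord)
  finally show ?thesis by simp
qed

lemma natural_ip_sums:
  assumes "U \<in> phase i"
  shows "(\<lambda>n. wnorm2 i (\<mu> n) (coords \<phi> n U)) sums Re (natural_ip L \<mu> \<phi> i U U)"
proof -
  obtain u v w where U: "U = (u, v, w)" by (cases U)
  note pow = ip_via_pow_op[where s = "1/2", unfolded powr_squares]
    ip_via_pow_op[where s = "3/2", unfolded powr_squares]
  have one: "(\<lambda>n. (cmod (coord x n))\<^sup>2) sums Re (cinner x x)" for x
    using Parseval_norm[of x] by (simp add: cinner_self)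
  show ?thesis
    using assms
    by (cases i)
      (auto simp: wnorm2_def sum_3 U simp del: of_real_power intro!: sums_add one pow ip_via_L)
qed

lemma ip_norm_natural:
  "U \<in> phase i \<Longrightarrow> ip_norm (natural_ip L \<mu> \<phi> i) U = sqrt (\<Sum>n. wnorm2 i (\<mu> n) (coords \<phi> n U))"
  using natural_ip_sums by (simp add: ip_norm_def sums_iff)

lemma weight_bounded_below: "\<exists>c>0. \<forall>n k. c \<le> weight i (\<mu> n) $ k"
proof -
  define q where "q = min 1 (\<mu> 0)"
  have q: "0 < q" "q \<le> 1" using \<mu>_pos[of 0] by (auto simp: q_def)
  have q3: "q ^ 3 \<le> 1" "q ^ 3 \<le> q" "q ^ 3 \<le> q\<^sup>2"
    using q power_decreasing[of 1 3 q] power_decreasing[of 2 3 q] by (auto simp: power_le_one)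
  have "q ^ 3 \<le> weight i (\<mu> n) $ k" for n k
  proof -
    have "q \<le> \<mu> n" using monoD[OF mono, of 0 n] by (auto simp: q_def)
    then have "q ^ 3 \<le> \<mu> n" "q ^ 3 \<le> (\<mu> n)\<^sup>2" "q ^ 3 \<le> \<mu> n ^ 3"
      using q(1) q3 order.trans[OF q3(3) power_mono[of q "\<mu> n" 2]] power_mono[of q "\<mu> n" 3]
      by linarith+
    then show ?thesis using exhaust_3[of k] q3(1) by (cases i) auto
  qed
  then show ?thesis using q by (intro exI[of _ "q ^ 3"]) auto
qed

text \<open>The weights of each phase space are bounded below by a positive constant, as \<open>\<mu>\<close> is increasing with
\<open>\<mu> 0 > 0\<close>. So finite weighted norm implies that each component is square summable.\<close>

lemma coords_surj:
  assumes s: "summable (\<lambda>n. wnorm2 i (\<mu> n) (c n))"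
  shows "\<exists>U\<in>phase i. \<forall>n. coords \<phi> n U = c n"
proof -
  obtain q where q: "q > 0" "\<And>n k. q \<le> weight i (\<mu> n) $ k"
    using weight_bounded_below by blast
  have component: "summable (\<lambda>n. (cmod (c n $ k))\<^sup>2)" for k
  proof (rule summable_comparison_test'[OF summable_mult[OF s, of "1 / q"]])
    fix n :: nat
    have "q * (cmod (c n $ k))\<^sup>2 \<le> weight i (\<mu> n) $ k * (cmod (c n $ k))\<^sup>2"
      using q by (intro mult_right_mono) auto
    also have "\<dots> \<le> wnorm2 i (\<mu> n) (c n)"
      unfolding wnorm2_def
      by (rule member_le_sum) (auto simp: weight_pos[OF \<mu>_pos] less_imp_le)
    finally show "norm ((cmod (c n $ k))\<^sup>2) \<le> 1 / q * wnorm2 i (\<mu> n) (c n)"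
      using q(1) by (simp add: field_simps)
  qed
  define U where "U = ((\<Sum>n. c n $ 1 *\<^sub>C \<phi> n), (\<Sum>n. c n $ 2 *\<^sub>C \<phi> n), (\<Sum>n. c n $ 3 *\<^sub>C \<phi> n))"
  have "coords \<phi> n U = c n" for n
    by (simp add: U_def vec_eq_iff forall_3 Riesz_Fischer component)
  then show ?thesis using s by (auto simp: phase_iff intro!: bexI[of _ U])
qed

lemma coords_operator:
  assumes "u + \<beta> *\<^sub>R v \<in> D"
  shows "coords \<phi> n (operator (u, v, w)) = evolve \<alpha> \<beta> (\<mu> n) (coords \<phi> n (u, v, w))"
proof -
  have neg: "cinner x (- y) = - cinner x y" for x y :: 'a
    using cinner_simps(3)[of x 0 y] by simp
  have "coord (L (u + \<beta> *\<^sub>R v)) n = \<mu> n * (coord u n + \<beta> * coord v n)"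
    using coord_L[OF assms] by (simp add: cinner_simps cinner_scaleR)
  then show ?thesis
    by (simp add: mgt_op_def evolve_def vec_eq_iff forall_3 cinner_simps(3) cinner_scaleR neg)
qed

lemma embed_phase: "embed \<phi> n x \<in> phase i"
  unfolding phase_iff by (rule summable_finite[of "{n}"]) (auto simp: coords_embed wnorm2_def)

lemma embed_domain: "embed \<phi> n x \<in> domain i"
  and operator_embed: "operator (embed \<phi> n x) = embed \<phi> n (evolve \<alpha> \<beta> (\<mu> n) x)"
proof -
  have "x $ 1 *\<^sub>C \<phi> n + \<beta> *\<^sub>R (x $ 2 *\<^sub>C \<phi> n) \<in> D"
    unfolding scaleR_scaleC
    by (intro scaleC.subspace_add[OF csubspace_D] scaleC.subspace_scale[OF csubspace_D] eigen(1))
  then have D: "fst (embed \<phi> n x) + \<beta> *\<^sub>R fst (snd (embed \<phi> n x)) \<in> D"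
    by (simp add: embed_def)
  have "evolve \<alpha> \<beta> m 0 = 0" for m
    by (simp add: evolve_def vec_eq_iff forall_3)
  then have "coords \<phi> m (operator (embed \<phi> n x)) = coords \<phi> m (embed \<phi> n (evolve \<alpha> \<beta> (\<mu> n) x))" for m
    using coords_operator[OF D, of m "snd (snd (embed \<phi> n x))"] by (simp add: coords_embed)
  then show op: "operator (embed \<phi> n x) = embed \<phi> n (evolve \<alpha> \<beta> (\<mu> n) x)"
    by (rule coords_eqI)
  obtain u v w where e: "embed \<phi> n x = (u, v, w)" by (cases "embed \<phi> n x")
  then show "embed \<phi> n x \<in> domain i"
    using D embed_phase[of n x i] embed_phase[of n "evolve \<alpha> \<beta> (\<mu> n) x" i] op
    by (simp add: mgt_dom_def)
qed

section \<open>Multiple characteristic roots\<close>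

lemma double_root:
  assumes "factors_cubic \<alpha> \<beta> m l l z"
  shows "of_real \<alpha> * l ^ 3 + l\<^sup>2 + of_real (\<beta> * m) * l + of_real m = 0"
    and "3 * of_real \<alpha> * l\<^sup>2 + 2 * l + of_real (\<beta> * m) = 0"
proof -
  show "of_real \<alpha> * l ^ 3 + l\<^sup>2 + of_real (\<beta> * m) * l + of_real m = 0"
    using root_of_cubic[OF assms] by blast
  show "3 * of_real \<alpha> * l\<^sup>2 + 2 * l + of_real (\<beta> * m) = 0"
    using Vieta(1,2)[OF assms] by algebra
qed

lemma evolve_root_vec:
  assumes "of_real \<alpha> * l ^ 3 + l\<^sup>2 + of_real (\<beta> * m) * l + of_real m = 0"
  shows "evolve \<alpha> \<beta> m (root_vec l) = l *s root_vec l"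
proof -
  define a where "a = complex_of_real \<alpha>"
  have a: "a \<noteq> 0" using pos by (simp add: a_def)
  have eq: "a * l ^ 3 + l\<^sup>2 + of_real \<beta> * of_real m * l + of_real m = 0"
    using assms by (simp add: a_def)
  have "a * (- (of_real m / a * (1 + of_real \<beta> * l)) - 1 / a * l\<^sup>2) = a * l ^ 3"
    using a by (simp add: right_diff_distrib) (use eq in algebra)
  then have "- (of_real m / a * (1 + of_real \<beta> * l)) - 1 / a * l\<^sup>2 = l ^ 3" using a by simp
  then show ?thesis
    by (simp add: evolve_def root_vec_def vec_eq_iff forall_3 a_def power2_eq_square power3_eq_cube)
qed

text \<open>For a double root \<open>l\<close> the vector \<open>(0, 1, 2 l)\<close>, the derivative of the eigenvector \<open>(1, l, l\<^sup>2)\<close> with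
respect to \<open>l\<close>, is a generalized eigenvector: differentiating the eigenvalue equation gives an error
term proportional to the derivative of the cubic, which vanishes at \<open>l\<close>. Together with the
eigenvector it forms a Jordan chain.\<close>

lemma not_normal:
  assumes double: "of_real (\<mu> n) = m1 \<alpha> \<beta> \<or> of_real (\<mu> n) = m2 \<alpha> \<beta>"
    and ip: "is_scalar_product (phase i) ip"
  shows "\<not> normal_operator (phase i) ip (domain i) operator"
proof
  assume normal: "normal_operator (phase i) ip (domain i) operator"
  interpret ip: scalar_product_on "phase i" ip by unfold_locales (rule ip)
  note cubic = factors[of n]
  (* A root of multiplicity two or three, listed first and second. *)
  have "\<exists>l z. factors_cubic \<alpha> \<beta> (\<mu> n) l l z"
    using double[unfolded multiple_root_iff[OF pos \<mu>_pos cubic]] cubic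
    by (metis factors_cubic_swap)
  then obtain l z where l: "factors_cubic \<alpha> \<beta> (\<mu> n) l l z" by blast
  define a where "a = complex_of_real \<alpha>"
  have a: "a \<noteq> 0" using pos by (simp add: a_def)
  define x where "x = embed \<phi> n (vector [0, 1, 2 * l])"
  define y where "y = embed \<phi> n (root_vec l)"
  have embed_scale: "embed \<phi> n (c *s v) = c *\<^sub>C embed \<phi> n v"
    and embed_add: "embed \<phi> n (v + w) = embed \<phi> n v + embed \<phi> n w" for c v w
    by (simp_all add: embed_def scaleC_prod_def scaleC_scaleC scaleC_add_left)
  have eq: "3 * a * l\<^sup>2 + 2 * l + of_real \<beta> * of_real (\<mu> n) = 0"
    using double_root(2)[OF l] by (simp add: a_def)
  have "a * (- (of_real (\<mu> n) / a * of_real \<beta>) - 1 / a * (2 * l)) = a * (3 * l\<^sup>2)"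
    using a by (simp add: right_diff_distrib) (use eq in algebra)
  then have "- (of_real (\<mu> n) / a * of_real \<beta>) - 1 / a * (2 * l) = 3 * l\<^sup>2"
    using a by simp
  then have "evolve \<alpha> \<beta> (\<mu> n) (vector [0, 1, 2 * l]) = l *s vector [0, 1, 2 * l] + root_vec l"
    by (simp add: evolve_def root_vec_def vec_eq_iff forall_3 a_def power2_eq_square)
  then have "operator x = l *\<^sub>C x + y"
    by (simp add: x_def y_def operator_embed embed_scale embed_add)
  moreover have "operator y = l *\<^sub>C y"
    by (simp add: y_def operator_embed evolve_root_vec[OF double_root(1)[OF l]] embed_scale)
  ultimately have "y = 0"
    using ip.normal_operator_no_Jordan_chain[OF normal] embed_domain unfolding x_def y_def by blast
  then have "coords \<phi> n y = 0" by (simp add: vec_eq_iff forall_3 zero_prod_def)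
  then show False by (simp add: y_def coords_embed root_vec_def vec_eq_iff forall_3)
qed

end

section \<open>Distinct characteristic roots\<close>

locale distinct_mgt = mgt + distinct_characteristic_cubic
begin

definition eigen_coords :: "space_index \<Rightarrow> 'a \<times> 'a \<times> 'a \<Rightarrow> nat \<Rightarrow> complex^3" where
  "eigen_coords i U n = matrix_inv (C_mat \<mu> \<rho> i n) *v coords \<phi> n U"

lemma coords_eq: "coords \<phi> n U = C_mat \<mu> \<rho> i n *v eigen_coords i U n"
  by (simp add: eigen_coords_def C_mat_inverse)

lemma G_term_eq: "G_term \<mu> \<phi> \<rho> i U W n = hdot (eigen_coords i U n) (eigen_coords i W n)"
proof -
  define B where "B = matrix_inv (C_mat \<mu> \<rho> i n)"
  have "herm_form (transpose (map_matrix cnj B) ** B) x y = hdot (B *v x) (B *v y)" for x y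
    by (simp add: herm_form_def hdot_def matrix_vector_mult_def matrix_matrix_mult_def
        transpose_def map_matrix_def sum_3 algebra_simps)
  then show ?thesis by (simp add: G_term_def G_mat_def eigen_coords_def B_def)
qed

text \<open>The two estimates for the eigenvector bases translate the weighted summability condition of the phase
space into plain square summability of the coordinates with respect to the eigenvectors.\<close>

lemma phase_iff_eigen_coords: "U \<in> phase i \<longleftrightarrow> summable (\<lambda>n. (norm (eigen_coords i U n))\<^sup>2)"
proof
  obtain K where K: "\<And>n a. (norm a)\<^sup>2 \<le> K * wnorm2 i (\<mu> n) (C_mat \<mu> \<rho> i n *v a)"
    using Riesz_bound[of i] by blast
  assume "U \<in> phase i"
  then have s: "summable (\<lambda>n. K * wnorm2 i (\<mu> n) (coords \<phi> n U))"
    by (simp add: phase_iff summable_mult)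
  have "norm ((norm (eigen_coords i U n))\<^sup>2) \<le> K * wnorm2 i (\<mu> n) (coords \<phi> n U)" for n
    using K[of "eigen_coords i U n" n] by (simp add: coords_eq[of n U i])
  then show "summable (\<lambda>n. (norm (eigen_coords i U n))\<^sup>2)"
    by (rule summable_comparison_test'[OF s])
next
  assume "summable (\<lambda>n. (norm (eigen_coords i U n))\<^sup>2)"
  then have s: "summable (\<lambda>n. 81 * (norm (eigen_coords i U n))\<^sup>2)" by (rule summable_mult)
  have "norm (wnorm2 i (\<mu> n) (coords \<phi> n U)) \<le> 81 * (norm (eigen_coords i U n))\<^sup>2" for n
    using wnorm2_C_mat_le[of i n "eigen_coords i U n"] wnorm2_nonneg[OF \<mu>_pos]
    by (simp add: coords_eq[of n U i])
  then show "U \<in> phase i"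
    unfolding phase_iff by (rule summable_comparison_test'[OF s])
qed

lemma eigen_coords_surj:
  assumes "summable (\<lambda>n. (norm (s n))\<^sup>2)"
  shows "\<exists>U\<in>phase i. \<forall>n. eigen_coords i U n = s n"
proof -
  have s: "summable (\<lambda>n. 81 * (norm (s n))\<^sup>2)" using assms by (rule summable_mult)
  have "norm (wnorm2 i (\<mu> n) (C_mat \<mu> \<rho> i n *v s n)) \<le> 81 * (norm (s n))\<^sup>2" for n
    using wnorm2_C_mat_le[of i n "s n"] wnorm2_nonneg[OF \<mu>_pos] by simp
  then have "summable (\<lambda>n. wnorm2 i (\<mu> n) (C_mat \<mu> \<rho> i n *v s n))"
    by (rule summable_comparison_test'[OF s])
  from coords_surj[OF this] obtain U
    where "U \<in> phase i" and "\<And>n. coords \<phi> n U = C_mat \<mu> \<rho> i n *v s n" by blast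
  then show ?thesis
    by (intro bexI[of _ U]) (simp_all add: eigen_coords_def C_mat_inverse)
qed

lemma eigen_coords_inj:
  assumes "\<And>n. eigen_coords i U n = 0"
  shows "U = 0"
proof (rule coords_eqI)
  fix n
  have "coords \<phi> n U = 0" using assms[of n] by (simp add: coords_eq[of n U i])
  then show "coords \<phi> n U = coords \<phi> n 0" by (simp add: vec_eq_iff forall_3 zero_prod_def)
qed

lemma eigen_coords_add: "eigen_coords i (U + W) n = eigen_coords i U n + eigen_coords i W n"
  by (simp add: eigen_coords_def coords_add matrix_vector_right_distrib)

lemma eigen_coords_scale: "eigen_coords i (c *\<^sub>C U) n = c *s eigen_coords i U n"
  by (simp add: eigen_coords_def coords_scaleC vector_scalar_commute)

lemma phase_subspace: "csubspace (phase i)"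
proof (rule scaleC.subspaceI)
  show "0 \<in> phase i"
    unfolding phase_iff by (simp add: wnorm2_def sum_3 zero_prod_def)
  show "U + W \<in> phase i" if "U \<in> phase i" "W \<in> phase i" for U W
  proof -
    let ?a = "eigen_coords i"
    have s: "summable (\<lambda>n. 2 * (norm (?a U n))\<^sup>2 + 2 * (norm (?a W n))\<^sup>2)"
      using that by (intro summable_add summable_mult) (simp_all add: phase_iff_eigen_coords)
    have "norm ((norm (?a (U + W) n))\<^sup>2) \<le> 2 * (norm (?a U n))\<^sup>2 + 2 * (norm (?a W n))\<^sup>2" for n
    proof -
      have "(norm (?a (U + W) n))\<^sup>2 \<le> (norm (?a U n) + norm (?a W n))\<^sup>2"
        unfolding eigen_coords_add by (intro power_mono norm_triangle_ineq) simp
      also have "\<dots> \<le> 2 * (norm (?a U n))\<^sup>2 + 2 * (norm (?a W n))\<^sup>2"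
        using sum_squares_bound[of "norm (?a U n)" "norm (?a W n)"] by (simp add: power2_sum)
      finally show ?thesis by simp
    qed
    then show ?thesis
      unfolding phase_iff_eigen_coords by (rule summable_comparison_test'[OF s])
  qed
  show "c *\<^sub>C U \<in> phase i" if "U \<in> phase i" for c U
  proof -
    have "(norm (c *s v))\<^sup>2 = (cmod c)\<^sup>2 * (norm v)\<^sup>2" for v :: "complex^3"
      by (simp add: norm_square_cart norm_mult power_mult_distrib sum_distrib_left)
    then show ?thesis
      using that by (simp add: phase_iff_eigen_coords eigen_coords_scale summable_mult)
  qed
qed

lemma C_mat_axis: "C_mat \<mu> \<rho> i n *v axis j 1 = psi_vec \<mu> \<rho> i n j"
  by (simp add: matrix_vector_mult_def C_mat_def axis_def vec_eq_iff if_distrib[of "\<lambda>t. _ * t"] cong: if_cong)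

lemma eigen_coords_Psi:
  "eigen_coords i (Psi \<mu> \<phi> \<rho> i (n, j)) m = (if m = n then axis j 1 else 0)"
  using C_mat_inverse(2)[of i n "axis j 1"]
  by (auto simp: eigen_coords_def Psi_def coords_embed C_mat_axis)

lemma square_summable:
  "square_summable_coordinates (phase i) (eigen_coords i) (Psi \<mu> \<phi> \<rho> i)"
proof
  show "csubspace (phase i)" by (rule phase_subspace)
  show "eigen_coords i (x + y) n = eigen_coords i x n + eigen_coords i y n" for x y n
    by (rule eigen_coords_add)
  show "eigen_coords i (c *\<^sub>C x) n = c *s eigen_coords i x n" for c x n
    by (rule eigen_coords_scale)
  show "summable (\<lambda>n. (norm (eigen_coords i x n))\<^sup>2)" if "x \<in> phase i" for x
    using that by (simp add: phase_iff_eigen_coords)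
  show "\<exists>x\<in>phase i. \<forall>n. eigen_coords i x n = s n" if "summable (\<lambda>n. (norm (s n))\<^sup>2)" for s
    using that by (rule eigen_coords_surj)
  show "x = 0" if "\<And>n. eigen_coords i x n = 0" for x
    using that by (rule eigen_coords_inj)
  show "Psi \<mu> \<phi> \<rho> i k \<in> phase i" for k
    by (cases k) (simp add: Psi_def embed_phase)
  show "eigen_coords i (Psi \<mu> \<phi> \<rho> i (n, j)) m = (if m = n then axis j 1 else 0)" for n j m
    by (rule eigen_coords_Psi)
qed

lemma root: "of_real \<alpha> * \<rho> n j ^ 3 + (\<rho> n j)\<^sup>2 + of_real (\<beta> * \<mu> n) * \<rho> n j + of_real (\<mu> n) = 0"
  using root_of_cubic[OF factors, of "\<rho> n j" n] exhaust_3[of j] by auto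

lemma evolve_C_mat:
  "evolve \<alpha> \<beta> (\<mu> n) (C_mat \<mu> \<rho> i n *v b) = C_mat \<mu> \<rho> i n *v (\<chi> j. \<rho> n j * b $ j)"
proof -
  have add: "evolve \<alpha> \<beta> m (x + y) = evolve \<alpha> \<beta> m x + evolve \<alpha> \<beta> m y" for m x y
    by (simp add: evolve_def vec_eq_iff forall_3 algebra_simps)
  have scale: "evolve \<alpha> \<beta> m (c *s x) = c *s evolve \<alpha> \<beta> m x" for m c x
    by (simp add: evolve_def vec_eq_iff forall_3 algebra_simps)
  define p where "p j = complex_of_real (1 / psi_norm \<mu> \<rho> i n j)" for j
  have C: "C_mat \<mu> \<rho> i n *v v = (v $ 1 * p 1) *s root_vec (\<rho> n 1) + (v $ 2 * p 2) *s root_vec (\<rho> n 2)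
      + (v $ 3 * p 3) *s root_vec (\<rho> n 3)" for v
    by (simp add: vec_eq_iff matrix_vector_mult_def C_mat_def psi_vec_def p_def sum_3
        scaleR_conv_of_real[where 'a = complex] mult_ac)
  show ?thesis
    unfolding C add scale evolve_root_vec[OF root] by (simp add: vec_eq_iff mult_ac)
qed

text \<open>The domain of the operator is the maximal domain of a diagonal operator. The point is that
\<open>u + \<beta> v \<in> D\<close> follows from summability: the candidate \<open>Z\<close> for the image has a third component
\<open>z3\<close> in the Hilbert space, and the third row of the companion matrix expresses the sequence
\<open>\<mu> n * coord (u + \<beta> v) n\<close> through the coordinates of \<open>z3\<close> and \<open>w\<close>.\<close>

lemma domain_iff:
  "U \<in> domain i \<longleftrightarrow>
    U \<in> phase i \<and> summable (\<lambda>n. (norm (\<chi> j. \<rho> n j * eigen_coords i U n $ j))\<^sup>2)"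
  and operator_phase: "U \<in> domain i \<Longrightarrow> operator U \<in> phase i"
  and eigen_coords_operator:
    "U \<in> domain i \<Longrightarrow> eigen_coords i (operator U) n = (\<chi> j. \<rho> n j * eigen_coords i U n $ j)"
proof -
  obtain u v w where U: "U = (u, v, w)" by (cases U)
  have op: "coords \<phi> n (operator U) = C_mat \<mu> \<rho> i n *v (\<chi> j. \<rho> n j * eigen_coords i U n $ j)"
    if "u + \<beta> *\<^sub>R v \<in> D" for n
    using coords_operator[OF that, of n w] by (simp add: U coords_eq[of n "(u, v, w)" i] evolve_C_mat)
  then have op': "eigen_coords i (operator U) n = (\<chi> j. \<rho> n j * eigen_coords i U n $ j)"
    if "u + \<beta> *\<^sub>R v \<in> D" for n
    using that by (simp add: eigen_coords_def[of i "operator U"] C_mat_inverse)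
  have dom: "u + \<beta> *\<^sub>R v \<in> D" "U \<in> phase i" "operator U \<in> phase i" if "U \<in> domain i"
    using that by (auto simp: mgt_dom_def U)
  show "operator U \<in> phase i" if "U \<in> domain i" using dom(3)[OF that] .
  show "eigen_coords i (operator U) n = (\<chi> j. \<rho> n j * eigen_coords i U n $ j)" if "U \<in> domain i" for n
    using op'[OF dom(1)[OF that]] .
  show "U \<in> domain i \<longleftrightarrow>
    U \<in> phase i \<and> summable (\<lambda>n. (norm (\<chi> j. \<rho> n j * eigen_coords i U n $ j))\<^sup>2)"
  proof (intro iffI conjI; (elim conjE)?)
    assume "U \<in> domain i"
    from dom[OF this] show "summable (\<lambda>n. (norm (\<chi> j. \<rho> n j * eigen_coords i U n $ j))\<^sup>2)"
      unfolding phase_iff_eigen_coords by (simp only: op')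
  next
    assume UV: "U \<in> phase i"
      and "summable (\<lambda>n. (norm (\<chi> j. \<rho> n j * eigen_coords i U n $ j))\<^sup>2)"
    then obtain Z where Z: "Z \<in> phase i"
      "\<And>n. eigen_coords i Z n = (\<chi> j. \<rho> n j * eigen_coords i U n $ j)"
      using eigen_coords_surj[of "\<lambda>n. \<chi> j. \<rho> n j * eigen_coords i U n $ j" i] by blast
    obtain z1 z2 z3 where Z3: "Z = (z1, z2, z3)" by (cases Z)
    have "coords \<phi> n Z = evolve \<alpha> \<beta> (\<mu> n) (coords \<phi> n U)" for n
      by (simp add: coords_eq[of n _ i] Z(2) evolve_C_mat)
    then have "coords \<phi> n Z $ 3 = evolve \<alpha> \<beta> (\<mu> n) (coords \<phi> n U) $ 3" for n by simp
    then have z3: "coord z3 n = - (of_real (\<mu> n / \<alpha>) * (coord u n + of_real \<beta> * coord v n))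
        - of_real (1 / \<alpha>) * coord w n" for n
      by (simp add: Z3 U evolve_def)
    have "of_real (\<mu> n) * coord (u + \<beta> *\<^sub>R v) n = - coord (\<alpha> *\<^sub>R z3 + w) n" for n
      using pos by (simp add: cinner_simps cinner_scaleR z3 field_simps)
    then have "summable (\<lambda>n. (cmod (of_real (\<mu> n) * coord (u + \<beta> *\<^sub>R v) n))\<^sup>2)"
      using summable_coord[of "\<alpha> *\<^sub>R z3 + w"] by simp
    then have D: "u + \<beta> *\<^sub>R v \<in> D" by (subst domain_eq) simp
    have "operator U = Z"
      by (rule coords_eqI) (simp add: op[OF D] coords_eq[of _ Z i] Z(2))
    then show "U \<in> domain i" using D UV Z(1) by (simp add: mgt_dom_def U)
  qed (use dom in blast)
qed

sublocale diagonal: diagonal_operator "phase i" "eigen_coords i" "Psi \<mu> \<phi> \<rho> i" "domain i" operator \<rho>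
  for i
proof -
  interpret square_summable_coordinates "phase i" "eigen_coords i" "Psi \<mu> \<phi> \<rho> i"
    by (rule square_summable)
  show "diagonal_operator (phase i) (eigen_coords i) (Psi \<mu> \<phi> \<rho> i) (domain i) operator \<rho>"
    by unfold_locales (fact domain_iff operator_phase eigen_coords_operator)+
qed

lemma G_ip_eq: "G_ip \<mu> \<phi> \<rho> i = diagonal.ip i"
  by (intro ext) (simp add: G_ip_def G_term_eq diagonal.ip_def)

lemma equivalent: "equivalent_norms (phase i) (G_ip \<mu> \<phi> \<rho> i) (natural_ip L \<mu> \<phi> i)"
  and natural_le: "U \<in> phase i \<Longrightarrow> ip_norm (natural_ip L \<mu> \<phi> i) U \<le> 9 * ip_norm (G_ip \<mu> \<phi> \<rho> i) U"
proof -
  obtain K where K: "K > 0" "\<And>n a. (norm a)\<^sup>2 \<le> K * wnorm2 i (\<mu> n) (C_mat \<mu> \<rho> i n *v a)"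
    using Riesz_bound[of i] by blast
  have upper: "ip_norm (G_ip \<mu> \<phi> \<rho> i) U \<le> sqrt K * ip_norm (natural_ip L \<mu> \<phi> i) U"
    if U: "U \<in> phase i" for U
  proof -
    have "(\<Sum>n. (norm (eigen_coords i U n))\<^sup>2) \<le> (\<Sum>n. K * wnorm2 i (\<mu> n) (coords \<phi> n U))"
    proof (rule suminf_le)
      show "(norm (eigen_coords i U n))\<^sup>2 \<le> K * wnorm2 i (\<mu> n) (coords \<phi> n U)" for n
        using K(2)[of "eigen_coords i U n" n] by (simp add: coords_eq[of n U i])
      show "summable (\<lambda>n. K * wnorm2 i (\<mu> n) (coords \<phi> n U))"
        using U by (intro summable_mult) (simp add: phase_iff)
    qed (use U in \<open>simp add: phase_iff_eigen_coords\<close>)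
    also have "\<dots> = K * (\<Sum>n. wnorm2 i (\<mu> n) (coords \<phi> n U))"
      using U by (intro suminf_mult) (simp add: phase_iff)
    finally show ?thesis
      using U by (simp add: G_ip_eq diagonal.ip_norm_eq ip_norm_natural flip: real_sqrt_mult)
  qed
  show lower: "ip_norm (natural_ip L \<mu> \<phi> i) U \<le> 9 * ip_norm (G_ip \<mu> \<phi> \<rho> i) U"
    if U: "U \<in> phase i" for U
  proof -
    have "(\<Sum>n. wnorm2 i (\<mu> n) (coords \<phi> n U)) \<le> (\<Sum>n. 81 * (norm (eigen_coords i U n))\<^sup>2)"
    proof (rule suminf_le)
      show "wnorm2 i (\<mu> n) (coords \<phi> n U) \<le> 81 * (norm (eigen_coords i U n))\<^sup>2" for n
        using wnorm2_C_mat_le[of i n "eigen_coords i U n"] by (simp add: coords_eq[of n U i])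
      show "summable (\<lambda>n. 81 * (norm (eigen_coords i U n))\<^sup>2)"
        using U by (intro summable_mult) (simp add: phase_iff_eigen_coords)
    qed (use U in \<open>simp add: phase_iff\<close>)
    also have "\<dots> = 81 * (\<Sum>n. (norm (eigen_coords i U n))\<^sup>2)"
      using U by (intro suminf_mult) (simp add: phase_iff_eigen_coords)
    finally have "sqrt (\<Sum>n. wnorm2 i (\<mu> n) (coords \<phi> n U))
        \<le> sqrt (9\<^sup>2 * (\<Sum>n. (norm (eigen_coords i U n))\<^sup>2))" by simp
    then show ?thesis
      using U by (simp add: G_ip_eq diagonal.ip_norm_eq ip_norm_natural real_sqrt_mult)
  qed
  show "equivalent_norms (phase i) (G_ip \<mu> \<phi> \<rho> i) (natural_ip L \<mu> \<phi> i)"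
    unfolding equivalent_norms_def
  proof (rule exI[of _ "1/9"], intro conjI exI[of _ "sqrt K"] ballI)
    fix U assume "U \<in> phase i"
    from lower[OF this] upper[OF this]
    show "1/9 * ip_norm (natural_ip L \<mu> \<phi> i) U \<le> ip_norm (G_ip \<mu> \<phi> \<rho> i) U"
      "ip_norm (G_ip \<mu> \<phi> \<rho> i) U \<le> sqrt K * ip_norm (natural_ip L \<mu> \<phi> i) U" by simp_all
  qed (use K(1) in simp_all)
qed

lemma complete_Psi: "complete_in (phase i) (natural_ip L \<mu> \<phi> i) (Psi \<mu> \<phi> \<rho> i)"
  unfolding complete_in_def dense_in_def
proof (intro conjI ballI allI impI)
  show sub: "cspan (range (Psi \<mu> \<phi> \<rho> i)) \<subseteq> phase i" by (rule diagonal.span_subset)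
  fix U and r :: real assume U: "U \<in> phase i" and r: "r > 0"
  then have "r / 9 > 0" by simp
  then obtain d where d: "d \<in> cspan (range (Psi \<mu> \<phi> \<rho> i))" "ip_norm (G_ip \<mu> \<phi> \<rho> i) (U - d) < r / 9"
    using diagonal.dense_span[of i] U unfolding dense_in_def G_ip_eq by meson
  have "U - d \<in> phase i" using U d(1) sub by (intro diagonal.mem) auto
  from natural_le[OF this] d(2) have "ip_norm (natural_ip L \<mu> \<phi> i) (U - d) < r" by linarith
  then show "\<exists>d\<in>cspan (range (Psi \<mu> \<phi> \<rho> i)). ip_norm (natural_ip L \<mu> \<phi> i) (U - d) < r"
    using d(1) by blast
qed

lemma eigenvector_Psi: "eigenvector_of (domain i) operator (Psi \<mu> \<phi> \<rho> i k)"
proof -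
  obtain n j where k: "k = (n, j)" by (cases k)
  have "Psi \<mu> \<phi> \<rho> i k \<noteq> 0"
    using diagonal.a_e[of i n j n] diagonal.a_zero[of i n] by (auto simp: k axis_eq_0_iff)
  then show ?thesis
    using diagonal.e_in_E[of i k] diagonal.T_e[of i n j] unfolding eigenvector_of_def k by blast
qed

end

theorem theorem1:
  fixes \<alpha> \<beta> :: real
    and D :: "'a::complex_hilbert set" and L :: "'a \<Rightarrow> 'a"
    and \<mu> :: "nat \<Rightarrow> real" and \<phi> :: "nat \<Rightarrow> 'a"
    and \<rho> :: "nat \<Rightarrow> 3 \<Rightarrow> complex"
  assumes "\<alpha> > 0" and "\<beta> > 0"
    and "self_adjoint UNIV cinner D L"
    and "strictly_positive D L"
    and "compact_resolvent D L"
    and "spectral_data D L \<mu> \<phi>"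
    and "characteristic_roots \<alpha> \<beta> \<mu> \<rho>"
  shows
    "((\<forall>n. complex_of_real (\<mu> n) \<noteq> m1 \<alpha> \<beta> \<and> complex_of_real (\<mu> n) \<noteq> m2 \<alpha> \<beta>) \<longrightarrow>
       (\<forall>i. (\<forall>U\<in>phase_space D \<mu> \<phi> i. \<forall>V\<in>phase_space D \<mu> \<phi> i. summable (G_term \<mu> \<phi> \<rho> i U V)) \<and>
            is_scalar_product (phase_space D \<mu> \<phi> i) (G_ip \<mu> \<phi> \<rho> i) \<and>
            equivalent_norms (phase_space D \<mu> \<phi> i) (G_ip \<mu> \<phi> \<rho> i) (natural_ip L \<mu> \<phi> i) \<and>
            normal_operator (phase_space D \<mu> \<phi> i) (G_ip \<mu> \<phi> \<rho> i)
              (mgt_dom \<alpha> \<beta> D L \<mu> \<phi> i) (mgt_op \<alpha> \<beta> L) \<and>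
            (\<forall>k. eigenvector_of (mgt_dom \<alpha> \<beta> D L \<mu> \<phi> i) (mgt_op \<alpha> \<beta> L) (Psi \<mu> \<phi> \<rho> i k)) \<and>
            orthonormal (G_ip \<mu> \<phi> \<rho> i) (Psi \<mu> \<phi> \<rho> i) \<and>
            complete_in (phase_space D \<mu> \<phi> i) (natural_ip L \<mu> \<phi> i) (Psi \<mu> \<phi> \<rho> i))) \<and>
     ((\<exists>n. complex_of_real (\<mu> n) = m1 \<alpha> \<beta> \<or> complex_of_real (\<mu> n) = m2 \<alpha> \<beta>) \<longrightarrow>
       (\<forall>i ip. is_scalar_product (phase_space D \<mu> \<phi> i) ip \<longrightarrow>
            \<not> normal_operator (phase_space D \<mu> \<phi> i) ip
                (mgt_dom \<alpha> \<beta> D L \<mu> \<phi> i) (mgt_op \<alpha> \<beta> L)))"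
proof -
  interpret mgt \<phi> D L \<mu> \<alpha> \<beta> \<rho>
    using assms(1-3,6,7) by unfold_locales (simp_all add: spectral_data_def)
  show ?thesis
  proof (intro conjI impI allI)
    fix i ip
    assume "\<exists>n. complex_of_real (\<mu> n) = m1 \<alpha> \<beta> \<or> complex_of_real (\<mu> n) = m2 \<alpha> \<beta>"
      and "is_scalar_product (phase_space D \<mu> \<phi> i) ip"
    then show "\<not> normal_operator (phase_space D \<mu> \<phi> i) ip
        (mgt_dom \<alpha> \<beta> D L \<mu> \<phi> i) (mgt_op \<alpha> \<beta> L)"
      using not_normal by blast
  next
    assume "\<forall>n. complex_of_real (\<mu> n) \<noteq> m1 \<alpha> \<beta> \<and> complex_of_real (\<mu> n) \<noteq> m2 \<alpha> \<beta>"
    then interpret distinct_mgt \<phi> D L \<mu> \<alpha> \<beta> \<rho>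
      by unfold_locales blast
    fix i
    show "\<forall>U\<in>phase_space D \<mu> \<phi> i. \<forall>V\<in>phase_space D \<mu> \<phi> i. summable (G_term \<mu> \<phi> \<rho> i U V)"
      using diagonal.summable_hdot[of _ i] by (simp add: G_term_eq[abs_def])
    show "is_scalar_product (phase_space D \<mu> \<phi> i) (G_ip \<mu> \<phi> \<rho> i)"
      unfolding G_ip_eq by (rule diagonal.is_scalar_product)
    show "equivalent_norms (phase_space D \<mu> \<phi> i) (G_ip \<mu> \<phi> \<rho> i) (natural_ip L \<mu> \<phi> i)"
      by (rule equivalent)
    show "normal_operator (phase_space D \<mu> \<phi> i) (G_ip \<mu> \<phi> \<rho> i)
        (mgt_dom \<alpha> \<beta> D L \<mu> \<phi> i) (mgt_op \<alpha> \<beta> L)"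
      unfolding G_ip_eq by (rule diagonal.normal)
    show "eigenvector_of (mgt_dom \<alpha> \<beta> D L \<mu> \<phi> i) (mgt_op \<alpha> \<beta> L) (Psi \<mu> \<phi> \<rho> i k)" for k
      by (rule eigenvector_Psi)
    show "orthonormal (G_ip \<mu> \<phi> \<rho> i) (Psi \<mu> \<phi> \<rho> i)"
      unfolding G_ip_eq by (rule diagonal.orthonormal_e)
    show "complete_in (phase_space D \<mu> \<phi> i) (natural_ip L \<mu> \<phi> i) (Psi \<mu> \<phi> \<rho> i)"
      by (rule complete_Psi)
  qed
qed

end
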